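(* Let $G$ be a countably infinite group, $\sigma\in Z^2(G,\mathbb{T})$ and $d\in ND_0^+(G)$. Assume that $(G,\sigma)$ has the heat property with respect to $d$, and let $x_0$ be any element of $C_r^*(G,\sigma)$. Then the function $u:[0,\infty)\to C_r^*(G,\sigma)$ given by $u(t)=M_t^d(x_0)$ for each $t\ge 0$ has, for every $t>0$, a Fourier series $\sum_{g\in G}\widehat{u(t)}(g)\Lambda_\sigma(g)$ which is convergent in operator norm, and $u$ is the unique solution of the heat problem on $C_r^*(G,\sigma)$ associated to $H_d^{\mathcal{C}}$ and $x_0$.
   Context: $Z^2(G,\mathbb{T})$ is the group of normalized 2-cocycles $\sigma:G\times G\to\mathbb{T}$ (i.e. $\sigma(g,h)\sigma(gh,k)=\sigma(h,k)\sigma(g,hk)$, $\sigma(g,e)=\sigma(e,g)=1$). $\Lambda_\sigma$ is the left regular $\sigma$-projective representation on $\ell^2(G)$: $\Lambda_\sigma(g)\delta_h=\sigma(g,h)\delta_{gh}$. $C_r^*(G,\sigma)$ is the operator-norm closure in $\mathcal{B}(\ell^2(G))$ of $\mathrm{Span}(\Lambda_\sigma(G))$. For $x\in C_r^*(G,\sigma)$, $\widehat{x}:=x\delta_e\in\ell^2(G)$, and the Fourier series of $x$ is $\sum_{g\in G}\widehat{x}(g)\Lambda_\sigma(g)$. Convergence of a series $\sum_{g\in G}x_g$ always means unordered convergence in operator norm: convergence of the net of finite partial sums indexed by the finite subsets of $G$ directed by inclusion. $CF(G,\sigma)$ is the set of $x\in C_r^*(G,\sigma)$ whose Fourier series is convergent.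 $ND_0^+(G)$ is the set of functions $d:G\to[0,\infty)$ with $d(e)=0$ that are negative definite: $d(g^{-1})=d(g)$ for all $g$, and $\sum_{i,j=1}^n\overline{b_i}b_j\,d(g_i^{-1}g_j)\le 0$ for all $n$, $g_1,\dots,g_n\in G$ and $b_1,\dots,b_n\in\mathbb{C}$ with $\sum_i b_i=0$. For $d\in ND_0^+(G)$ and $t\ge0$, $M_t^d$ denotes the (well-defined, unital, completely positive) bounded linear operator on $C_r^*(G,\sigma)$ determined by $M_t^d(\Lambda_\sigma(g))=e^{-td(g)}\Lambda_\sigma(g)$ for all $g\in G$. $(G,\sigma)$ has the heat property with respect to $d$ if $M_t^d(x)\in CF(G,\sigma)$ for every $x\in C_r^*(G,\sigma)$ and every $t>0$. Set $\mathcal{C}:=\{x\in C_r^*(G,\sigma):\sum_{g\in G}d(g)\widehat{x}(g)\Lambda_\sigma(g)\text{ is convergent}\}$ and define $H_d^{\mathcal{C}}:\mathcal{C}\to C_r^*(G,\sigma)$ by $H_d^{\mathcal{C}}(x):=-\sum_{g\in G}d(g)\widehat{x}(g)\Lambda_\sigma(g)$. A function $u:[0,\infty)\to C_r^*(G,\sigma)$ is a solution of the heat problem on $C_r^*(G,\sigma)$ associated to $H_d^{\mathcal{C}}$ and $x_0\in C_r^*(G,\sigma)$ if: $u(0)=x_0$; $u(t)\in\mathcal{C}$ for every $t>0$; $u$ is (norm-)differentiable on $(0,\infty)$ with $u'(t)=H_d^{\mathcal{C}}(u(t))$ for every $t>0$; and $\lim_{t\to0^+}\|u(t)-x_0\|=0$.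 *)

theory Defs
  imports "HOL-Analysis.Analysis" "HOL-Library.FuncSet"
begin

text \<open>Groups are types of class \<open>group_add\<close>, which is not assumed commutative: the
  product \<open>g h\<close>, the inverse and the unit \<open>e\<close> are written \<open>g + h\<close>, \<open>- g\<close> and \<open>0\<close>.\<close>

section \<open>The Hilbert space of square-summable functions and its bounded operators\<close>

typedef 'a ell2 = "{f :: 'a \<Rightarrow> complex. (\<lambda>x. (cmod (f x))\<^sup>2) summable_on UNIV}"
  morphisms ell2_fun Abs_ell2
  by (rule exI[of _ "\<lambda>_. 0"]) simp

setup_lifting type_definition_ell2

lemma square_summable_add:
  fixes f g :: "'a \<Rightarrow> complex"
  assumes "(\<lambda>x. (cmod (f x))\<^sup>2) summable_on UNIV" "(\<lambda>x. (cmod (g x))\<^sup>2) summable_on UNIV"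
  shows "(\<lambda>x. (cmod (f x + g x))\<^sup>2) summable_on UNIV"
proof (rule summable_on_comparison_test)
  show "(\<lambda>x. 2 * (cmod (f x))\<^sup>2 + 2 * (cmod (g x))\<^sup>2) summable_on UNIV"
    by (intro summable_on_add summable_on_cmult_right assms)
  show "(cmod (f x + g x))\<^sup>2 \<le> 2 * (cmod (f x))\<^sup>2 + 2 * (cmod (g x))\<^sup>2" for x
  proof -
    have "(cmod (f x + g x))\<^sup>2 \<le> (cmod (f x) + cmod (g x))\<^sup>2"
      by (intro power_mono norm_triangle_ineq) simp
    also have "\<dots> \<le> 2 * (cmod (f x))\<^sup>2 + 2 * (cmod (g x))\<^sup>2"
      using sum_squares_bound[of "cmod (f x)" "cmod (g x)"] by (simp add: power2_sum)
    finally show ?thesis .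
  qed
qed simp

lemma square_summable_mult:
  fixes f :: "'a \<Rightarrow> complex"
  assumes "(\<lambda>x. (cmod (f x))\<^sup>2) summable_on UNIV"
  shows "(\<lambda>x. (cmod (c * f x))\<^sup>2) summable_on UNIV"
  using summable_on_cmult_right[OF assms, of "(cmod c)\<^sup>2"]
  by (simp add: norm_mult power_mult_distrib)

instantiation ell2 :: (type) real_vector
begin
lift_definition zero_ell2 :: "'a ell2" is "\<lambda>_. 0" by simp
lift_definition plus_ell2 :: "'a ell2 \<Rightarrow> 'a ell2 \<Rightarrow> 'a ell2" is "\<lambda>f g x. f x + g x"
  by (rule square_summable_add)
lift_definition uminus_ell2 :: "'a ell2 \<Rightarrow> 'a ell2" is "\<lambda>f x. - f x" by simp
lift_definition minus_ell2 :: "'a ell2 \<Rightarrow> 'a ell2 \<Rightarrow> 'a ell2" is "\<lambda>f g x. f x - g x"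
  subgoal for f g using square_summable_add[of f "\<lambda>x. - g x"] by simp
  done
lift_definition scaleR_ell2 :: "real \<Rightarrow> 'a ell2 \<Rightarrow> 'a ell2" is "\<lambda>r f x. of_real r * f x"
  by (rule square_summable_mult)
instance
  by (standard; transfer) (auto simp: fun_eq_iff algebra_simps)
end

instantiation ell2 :: (type) real_inner
begin
definition inner_ell2 :: "'a ell2 \<Rightarrow> 'a ell2 \<Rightarrow> real"
  where "inner_ell2 f g = (\<Sum>\<^sub>\<infinity>x. ell2_fun f x \<bullet> ell2_fun g x)"
definition norm_ell2 :: "'a ell2 \<Rightarrow> real"
  where "norm_ell2 f = sqrt (\<Sum>\<^sub>\<infinity>x. (cmod (ell2_fun f x))\<^sup>2)"
definition dist_ell2 :: "'a ell2 \<Rightarrow> 'a ell2 \<Rightarrow> real"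
  where "dist_ell2 f g = norm (f - g)"
definition sgn_ell2 :: "'a ell2 \<Rightarrow> 'a ell2"
  where "sgn_ell2 f = f /\<^sub>R norm f"
definition uniformity_ell2 :: "('a ell2 \<times> 'a ell2) filter"
  where "uniformity_ell2 = (INF e\<in>{0<..}. principal {(f, g). dist f g < e})"
definition open_ell2 :: "'a ell2 set \<Rightarrow> bool"
  where "open_ell2 U \<longleftrightarrow> (\<forall>x\<in>U. \<forall>\<^sub>F (x', y) in uniformity. x' = x \<longrightarrow> y \<in> U)"
instance
proof
  have sq: "(\<lambda>x. (cmod (ell2_fun f x))\<^sup>2) summable_on UNIV" for f :: "'a ell2"
    using ell2_fun[of f] by simp
  have ip: "(\<lambda>x. ell2_fun f x \<bullet> ell2_fun g x) summable_on UNIV" for f g :: "'a ell2"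
  proof -
    have "(\<lambda>x. norm (ell2_fun f x \<bullet> ell2_fun g x)) summable_on UNIV"
    proof (rule summable_on_comparison_test)
      show "(\<lambda>x. (cmod (ell2_fun f x))\<^sup>2 + (cmod (ell2_fun g x))\<^sup>2) summable_on UNIV"
        by (intro summable_on_add sq)
      show "norm (ell2_fun f x \<bullet> ell2_fun g x) \<le> (cmod (ell2_fun f x))\<^sup>2 + (cmod (ell2_fun g x))\<^sup>2" for x
        using Cauchy_Schwarz_ineq2[of "ell2_fun f x" "ell2_fun g x"]
          sum_squares_bound[of "cmod (ell2_fun f x)" "cmod (ell2_fun g x)"]
          mult_nonneg_nonneg[OF norm_ge_zero[of "ell2_fun f x"] norm_ge_zero[of "ell2_fun g x"]]
        unfolding real_norm_def by linarith
    qed simp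
    then show ?thesis by (rule abs_summable_summable)
  qed
  fix f g h :: "'a ell2" and r :: real
  show "dist f g = norm (f - g)" by (rule dist_ell2_def)
  show "sgn f = f /\<^sub>R norm f" by (rule sgn_ell2_def)
  show "uniformity = (INF e\<in>{0<..}. principal {(f, g::'a ell2). dist f g < e})"
    by (rule uniformity_ell2_def)
  show "open U \<longleftrightarrow> (\<forall>x\<in>U. \<forall>\<^sub>F (x', y) in uniformity. x' = x \<longrightarrow> y \<in> U)" for U :: "'a ell2 set"
    by (rule open_ell2_def)
  show "f \<bullet> g = g \<bullet> f" by (simp add: inner_ell2_def inner_commute)
  show "(f + g) \<bullet> h = f \<bullet> h + g \<bullet> h"
    by (simp add: inner_ell2_def plus_ell2.rep_eq inner_add_left infsum_add ip)
  show "(r *\<^sub>R f) \<bullet> g = r * (f \<bullet> g)"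
    by (simp add: inner_ell2_def scaleR_ell2.rep_eq scaleR_conv_of_real[symmetric]
        infsum_cmult_right' del: inner_complex_def)
  show "0 \<le> f \<bullet> f" by (simp add: inner_ell2_def infsum_nonneg)
  show "f \<bullet> f = 0 \<longleftrightarrow> f = 0"
  proof
    assume *: "f \<bullet> f = 0"
    have "ell2_fun f x = 0" for x
      using nonneg_infsum_le_0D[of "\<lambda>x. ell2_fun f x \<bullet> ell2_fun f x" UNIV x] * ip[of f f]
      by (simp add: inner_ell2_def)
    then show "f = 0" by (transfer) (auto simp: fun_eq_iff)
  qed (simp add: inner_ell2_def zero_ell2.rep_eq)
  show "norm f = sqrt (f \<bullet> f)"
    by (simp add: norm_ell2_def inner_ell2_def power2_norm_eq_inner)
qed
end

lift_definition scaleC_ell2 :: "complex \<Rightarrow> 'a ell2 \<Rightarrow> 'a ell2" is "\<lambda>c f x. c * f x"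
  by (rule square_summable_mult)

lift_definition delta :: "'a \<Rightarrow> 'a ell2" is "\<lambda>a x. if x = a then 1 else 0"
  subgoal for a by (rule finite_nonzero_values_imp_summable_on, rule finite_subset[of _ "{a}"]) auto
  done

lemma norm_scaleC_ell2: "norm (scaleC_ell2 c f) = cmod c * norm f"
  by (simp add: norm_ell2_def scaleC_ell2.rep_eq norm_mult power_mult_distrib
      infsum_cmult_right' real_sqrt_mult)

text \<open>Operators are elements of the normed space \<open>'a op\<close> with the operator norm. The type
  only enforces real linearity; all operators considered below are complex-linear.\<close>

type_synonym 'a op = "'a ell2 \<Rightarrow>\<^sub>L 'a ell2"

lemma bounded_linear_scaleC_ell2: "bounded_linear (scaleC_ell2 c :: 'a ell2 \<Rightarrow> 'a ell2)"
proof (rule bounded_linear_intro[where K = "cmod c"])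
  show "scaleC_ell2 c (x + y) = scaleC_ell2 c x + scaleC_ell2 c y" for x y :: "'a ell2"
    by transfer (simp add: fun_eq_iff distrib_left)
  show "scaleC_ell2 c (r *\<^sub>R x) = r *\<^sub>R scaleC_ell2 c x" for r and x :: "'a ell2"
    by transfer (simp add: fun_eq_iff mult.left_commute)
qed (simp add: norm_scaleC_ell2 mult.commute)

definition scaleC_op :: "complex \<Rightarrow> 'a op \<Rightarrow> 'a op" (infixr \<open>*\<^sub>C\<close> 75)
  where "c *\<^sub>C T = Blinfun (scaleC_ell2 c) o\<^sub>L T"

lemma scaleC_op_apply: "(c *\<^sub>C T) f = scaleC_ell2 c (T f)"
  by (simp add: scaleC_op_def bounded_linear_Blinfun_apply[OF bounded_linear_scaleC_ell2])


section \<open>Twisted reduced group algebras\<close>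

definition Z2 :: "('g::group_add \<Rightarrow> 'g \<Rightarrow> complex) set"
  where "Z2 = {\<sigma>. (\<forall>g h. cmod (\<sigma> g h) = 1)
    \<and> (\<forall>g h k. \<sigma> g h * \<sigma> (g + h) k = \<sigma> h k * \<sigma> g (h + k))
    \<and> (\<forall>g. \<sigma> g 0 = 1 \<and> \<sigma> 0 g = 1)}"

text \<open>The bounded operator given by \<open>\<delta>\<^sub>h \<mapsto> \<sigma>(g,h) \<delta>\<^sub>g\<^sub>h\<close>, written out on all of \<open>\<ell>\<^sup>2\<close>.
  It is meaningful for unimodular \<open>\<sigma>\<close> only.\<close>

definition Lam :: "('g::group_add \<Rightarrow> 'g \<Rightarrow> complex) \<Rightarrow> 'g \<Rightarrow> 'g op"
  where "Lam \<sigma> g = Blinfun (\<lambda>f. Abs_ell2 (\<lambda>k. \<sigma> g (- g + k) * ell2_fun f (- g + k)))"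

lemma ell2_fun_Lam:
  assumes "\<sigma> \<in> Z2"
  shows "ell2_fun (Lam \<sigma> g f) k = \<sigma> g (- g + k) * ell2_fun f (- g + k)"
proof -
  let ?L = "\<lambda>f. Abs_ell2 (\<lambda>k. \<sigma> g (- g + k) * ell2_fun f (- g + k))"
  have 1: "cmod (\<sigma> a b) = 1" for a b using assms by (simp add: Z2_def)
  have bij: "bij_betw (\<lambda>k. - g + k) UNIV UNIV"
    by (rule bij_betwI[where g = "\<lambda>k. g + k"]) (auto simp: add.assoc[symmetric])
  have "(\<lambda>k. (cmod (ell2_fun f (- g + k)))\<^sup>2) summable_on UNIV" for f :: "'a ell2"
    using ell2_fun[of f] summable_on_reindex_bij_betw[OF bij, of "\<lambda>k. (cmod (ell2_fun f k))\<^sup>2"]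
    by simp
  then have fn: "ell2_fun (?L f) = (\<lambda>k. \<sigma> g (- g + k) * ell2_fun f (- g + k))" for f
    by (intro Abs_ell2_inverse) (simp add: norm_mult 1)
  have "bounded_linear ?L"
  proof (rule bounded_linear_intro[where K = 1])
    show "?L (x + y) = ?L x + ?L y" for x y
      by (rule ell2_fun_inject[THEN iffD1], subst fn, unfold plus_ell2.rep_eq fn)
        (simp add: fun_eq_iff algebra_simps)
    show "?L (r *\<^sub>R x) = r *\<^sub>R ?L x" for r x
      by (rule ell2_fun_inject[THEN iffD1], subst fn, unfold scaleR_ell2.rep_eq fn)
        (simp add: fun_eq_iff algebra_simps)
    show "norm (?L x) \<le> norm x * 1" for x
      unfolding norm_ell2_def fn
      using infsum_reindex_bij_betw[OF bij, of "\<lambda>k. (cmod (ell2_fun x k))\<^sup>2"]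
      by (simp add: norm_mult 1)
  qed
  then show ?thesis by (simp add: Lam_def bounded_linear_Blinfun_apply fn)
qed

lemma Lam_delta:
  assumes "\<sigma> \<in> Z2"
  shows "Lam \<sigma> g (delta h) = scaleC_ell2 (\<sigma> g h) (delta (g + h))"
proof -
  have *: "- g + k = h \<longleftrightarrow> k = g + h" for k
    by (metis add.assoc add.left_inverse add.right_inverse add_0)
  show ?thesis
    by (rule ell2_fun_inject[THEN iffD1])
      (auto simp: fun_eq_iff ell2_fun_Lam[OF assms] scaleC_ell2.rep_eq delta.rep_eq *
        add.assoc[symmetric])
qed

definition Cr :: "('g::group_add \<Rightarrow> 'g \<Rightarrow> complex) \<Rightarrow> 'g op set"
  where "Cr \<sigma> = closure {\<Sum>g\<in>F. a g *\<^sub>C Lam \<sigma> g | a F. finite F}"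

definition fourier_coeff :: "'g::group_add op \<Rightarrow> 'g \<Rightarrow> complex"
  where "fourier_coeff x g = ell2_fun (x (delta 0)) g"

definition CF :: "('g::group_add \<Rightarrow> 'g \<Rightarrow> complex) \<Rightarrow> 'g op set"
  where "CF \<sigma> = {x \<in> Cr \<sigma>. (\<lambda>g. fourier_coeff x g *\<^sub>C Lam \<sigma> g) summable_on UNIV}"


section \<open>Negative definite functions and the heat problem\<close>

definition ND0 :: "('g::group_add \<Rightarrow> real) set"
  where "ND0 = {d. (\<forall>g. 0 \<le> d g) \<and> d 0 = 0 \<and> (\<forall>g. d (- g) = d g)
    \<and> (\<forall>(n::nat) (g :: nat \<Rightarrow> 'g) (b :: nat \<Rightarrow> complex). (\<Sum>i<n. b i) = 0 \<longrightarrow>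
        (\<Sum>i<n. \<Sum>j<n. cnj (b i) * b j * of_real (d (- g i + g j))) \<in> \<real>\<^sub>\<le>\<^sub>0)}"

text \<open>The bounded complex-linear map on \<open>Cr \<sigma>\<close> determined by
  \<open>\<Lambda>(g) \<mapsto> exp (- t d(g)) \<Lambda>(g)\<close>; as an element of the extensional function space it is unique.\<close>

definition heat_op :: "('g::group_add \<Rightarrow> 'g \<Rightarrow> complex) \<Rightarrow> ('g \<Rightarrow> real) \<Rightarrow> real \<Rightarrow> 'g op \<Rightarrow> 'g op"
  where "heat_op \<sigma> d t = (THE M. M \<in> Cr \<sigma> \<rightarrow>\<^sub>E Cr \<sigma>
    \<and> (\<forall>x\<in>Cr \<sigma>. \<forall>y\<in>Cr \<sigma>. M (x + y) = M x + M y)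
    \<and> (\<forall>c. \<forall>x\<in>Cr \<sigma>. M (c *\<^sub>C x) = c *\<^sub>C M x)
    \<and> (\<exists>K. \<forall>x\<in>Cr \<sigma>. norm (M x) \<le> K * norm x)
    \<and> (\<forall>g. M (Lam \<sigma> g) = of_real (exp (- t * d g)) *\<^sub>C Lam \<sigma> g))"

definition heat_property :: "('g::group_add \<Rightarrow> 'g \<Rightarrow> complex) \<Rightarrow> ('g \<Rightarrow> real) \<Rightarrow> bool"
  where "heat_property \<sigma> d \<longleftrightarrow> (\<forall>x\<in>Cr \<sigma>. \<forall>t>0. heat_op \<sigma> d t x \<in> CF \<sigma>)"

definition heat_dom :: "('g::group_add \<Rightarrow> 'g \<Rightarrow> complex) \<Rightarrow> ('g \<Rightarrow> real) \<Rightarrow> 'g op set"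
  where "heat_dom \<sigma> d =
    {x \<in> Cr \<sigma>. (\<lambda>g. (of_real (d g) * fourier_coeff x g) *\<^sub>C Lam \<sigma> g) summable_on UNIV}"

definition heat_gen :: "('g::group_add \<Rightarrow> 'g \<Rightarrow> complex) \<Rightarrow> ('g \<Rightarrow> real) \<Rightarrow> 'g op \<Rightarrow> 'g op"
  where "heat_gen \<sigma> d x = - (\<Sum>\<^sub>\<infinity>g. (of_real (d g) * fourier_coeff x g) *\<^sub>C Lam \<sigma> g)"

text \<open>Only the values of \<open>u\<close> on \<open>[0,\<infinity>)\<close> matter.\<close>

definition heat_solution ::
  "('g::group_add \<Rightarrow> 'g \<Rightarrow> complex) \<Rightarrow> ('g \<Rightarrow> real) \<Rightarrow> 'g op \<Rightarrow> (real \<Rightarrow> 'g op) \<Rightarrow> bool"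
  where "heat_solution \<sigma> d x0 u \<longleftrightarrow>
    (\<forall>t\<ge>0. u t \<in> Cr \<sigma>) \<and> u 0 = x0 \<and> (\<forall>t>0. u t \<in> heat_dom \<sigma> d)
    \<and> (\<forall>t>0. (u has_vector_derivative heat_gen \<sigma> d (u t)) (at t))
    \<and> ((\<lambda>t. norm (u t - x0)) \<longlongrightarrow> 0) (at_right 0)"

end

theory Submission
  imports Defs
begin

text \<open>By Schoenberg's theorem \<open>exp (- t d)\<close> is positive definite, and a Schur multiplier argument on
  finite matrices shows that multiplying Fourier coefficients by it is a contraction of \<open>Cr \<sigma>\<close>.
  Hence \<open>heat_op\<close> is described by its action on Fourier coefficients, which determine elements of
  \<open>Cr \<sigma>\<close>. Unordered convergence is preserved under bounded scalar multipliers, with a norm bound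
  linear in the bound of the multiplier; so differentiating the convergent series of
  \<open>exp (- s d)\<close>-damped terms reduces to the scalar Taylor estimate for \<open>exp\<close>. Uniqueness is read off
  the scalar equations satisfied by the Fourier coefficients.\<close>

section \<open>Square-summable functions\<close>

text \<open>The operator \<open>heat_op\<close> is given by a definite description, so nothing can
  be said about it until existence and uniqueness of the described map are proved, and existence
  rests on the norm bound for multipliers. Two obstacles shape the rest. The Fourier series of an
  arbitrary element of \<open>Cr \<sigma>\<close> need not converge in norm, so termwise arguments
  are confined to damped elements and to finite combinations. And an unordered convergent series of
  operators need not converge absolutely, so it cannot be dominated by a series of norms; a uniform
  bound on the norms of all finite partial sums takes over that role.\<close>

lemma ell2_eqI: "(\<And>k. ell2_fun f k = ell2_fun g k) \<Longrightarrow> f = g"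
  by (metis ell2_fun_inject ext)

lemma has_sum_norm_ell2: "((\<lambda>k. (cmod (ell2_fun f k))\<^sup>2) has_sum (norm f)\<^sup>2) UNIV"
proof -
  have "(\<lambda>k. (cmod (ell2_fun f k))\<^sup>2) summable_on UNIV"
    using ell2_fun[of f] by simp
  moreover have "(norm f)\<^sup>2 = (\<Sum>\<^sub>\<infinity>k. (cmod (ell2_fun f k))\<^sup>2)"
    by (simp add: norm_ell2_def infsum_nonneg)
  ultimately show ?thesis by simp
qed

lemma sum_cmod_square_le_norm_ell2:
  assumes "finite F"
  shows "(\<Sum>k\<in>F. (cmod (ell2_fun f k))\<^sup>2) \<le> (norm f)\<^sup>2"
  by (rule finite_sum_le_has_sum[OF has_sum_norm_ell2 assms]) auto

lemma cmod_ell2_fun_le: "cmod (ell2_fun f k) \<le> norm f"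
  using sum_cmod_square_le_norm_ell2[of "{k}" f] by (simp add: power2_le_iff_abs_le)

lemma bounded_linear_ell2_fun: "bounded_linear (\<lambda>f. ell2_fun f k)"
  by (rule bounded_linear_intro[where K = 1])
    (auto simp: plus_ell2.rep_eq scaleR_ell2.rep_eq scaleR_conv_of_real cmod_ell2_fun_le)

lemma ell2_fun_sum: "ell2_fun (\<Sum>i\<in>F. f i) k = (\<Sum>i\<in>F. ell2_fun (f i) k)"
  by (rule linear_sum[OF bounded_linear.linear[OF bounded_linear_ell2_fun]])

text \<open>Completeness passes on to the operator space \<open>'a op\<close>, where limits are
  needed both for Cauchy sequences of multiplied finite combinations and for nets of partial
  sums.\<close>

instance ell2 :: (type) banach
proof
  fix X :: "nat \<Rightarrow> 'a ell2"
  assume C: "Cauchy X"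
  have "Cauchy (\<lambda>n. ell2_fun (X n) k)" for k
    by (rule bounded_linear.Cauchy[OF bounded_linear_ell2_fun C])
  then obtain l where l: "(\<lambda>n. ell2_fun (X n) k) \<longlonglongrightarrow> l k" for k
    unfolding Cauchy_convergent_iff convergent_def by metis
  have fin: "(\<Sum>k\<in>F. (cmod (l k - ell2_fun (X n) k))\<^sup>2) \<le> e\<^sup>2"
    if "finite F" and N: "\<forall>m\<ge>n. norm (X m - X n) \<le> e" for F e n
  proof (rule LIMSEQ_le_const2)
    show "(\<lambda>m. \<Sum>k\<in>F. (cmod (ell2_fun (X m) k - ell2_fun (X n) k))\<^sup>2)
      \<longlonglongrightarrow> (\<Sum>k\<in>F. (cmod (l k - ell2_fun (X n) k))\<^sup>2)"
      by (intro tendsto_intros l)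
    have "(\<Sum>k\<in>F. (cmod (ell2_fun (X m) k - ell2_fun (X n) k))\<^sup>2) \<le> e\<^sup>2" if "m \<ge> n" for m
      using sum_cmod_square_le_norm_ell2[OF \<open>finite F\<close>, of "X m - X n"] N that
      by (smt (verit, best) minus_ell2.rep_eq norm_ge_zero power_mono sum.cong)
    then show "\<exists>N. \<forall>m\<ge>N. (\<Sum>k\<in>F. (cmod (ell2_fun (X m) k - ell2_fun (X n) k))\<^sup>2) \<le> e\<^sup>2"
      by blast
  qed
  \<comment> \<open>The coordinatewise limit l is not yet known to be square-summable. Its
    difference from one \<open>X n\<close> is, by the uniform bound on finite sums, and adding
    \<open>X n\<close> back gives l.\<close>
  have tail: "\<exists>z. (\<forall>k. ell2_fun z k = l k - ell2_fun (X n) k) \<and> norm z \<le> e"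
    if N: "\<forall>m\<ge>n. norm (X m - X n) \<le> e" for e n
  proof -
    have e: "e \<ge> 0" using N norm_ge_zero order_trans by blast
    have s: "(\<lambda>k. (cmod (l k - ell2_fun (X n) k))\<^sup>2) summable_on UNIV"
      by (rule nonneg_bdd_above_summable_on) (auto intro!: bdd_aboveI[of _ "e\<^sup>2"] fin[OF _ N])
    have eq: "ell2_fun (Abs_ell2 (\<lambda>k. l k - ell2_fun (X n) k)) = (\<lambda>k. l k - ell2_fun (X n) k)"
      by (rule Abs_ell2_inverse) (use s in simp)
    have "(\<Sum>\<^sub>\<infinity>k. (cmod (l k - ell2_fun (X n) k))\<^sup>2) \<le> e\<^sup>2"
      by (rule infsum_le_finite_sums[OF s fin[OF _ N]])
    then have "norm (Abs_ell2 (\<lambda>k. l k - ell2_fun (X n) k)) \<le> e"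
      unfolding norm_ell2_def eq using e by (simp add: real_le_lsqrt infsum_nonneg)
    then show ?thesis using eq by metis
  qed
  have cau: "\<exists>N. \<forall>n\<ge>N. \<forall>m\<ge>n. norm (X m - X n) \<le> e" if "e > 0" for e
    using C that unfolding Cauchy_def dist_norm by (meson dual_order.trans less_imp_le)
  obtain N where "\<forall>m\<ge>N. norm (X m - X N) \<le> 1" using cau[of 1] by auto
  from tail[OF this] obtain z where z: "\<And>k. ell2_fun z k = l k - ell2_fun (X N) k" by blast
  have lz: "ell2_fun (z + X N) k = l k" for k by (simp add: plus_ell2.rep_eq z)
  have "X \<longlonglongrightarrow> z + X N"
  proof (rule LIMSEQ_I)
    fix r :: real assume "r > 0"
    then obtain n0 where n0: "\<forall>n\<ge>n0. \<forall>m\<ge>n. norm (X m - X n) \<le> r / 2" using cau[of "r/2"] by auto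
    have "norm (X n - (z + X N)) < r" if "n \<ge> n0" for n
    proof -
      have "\<exists>w. (\<forall>k. ell2_fun w k = l k - ell2_fun (X n) k) \<and> norm w \<le> r / 2"
        by (rule tail) (use n0 that in blast)
      then obtain w where w: "\<And>k. ell2_fun w k = l k - ell2_fun (X n) k" "norm w \<le> r / 2"
        by blast
      have "X n - (z + X N) = - w"
        by (rule ell2_eqI) (simp add: minus_ell2.rep_eq uminus_ell2.rep_eq w lz)
      then show ?thesis using w(2) \<open>r > 0\<close> by simp
    qed
    then show "\<exists>n0. \<forall>n\<ge>n0. norm (X n - (z + X N)) < r" by blast
  qed
  then show "convergent X" by (rule convergentI)
qed

text \<open>Since \<open>'a op\<close> enforces real linearity only, an operator has to be tested on
  all complex multiples of a unit vector; hence the coefficient c.\<close>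

abbreviation basis_ell2 :: "complex \<Rightarrow> 'a \<Rightarrow> 'a ell2"
  where "basis_ell2 c k \<equiv> scaleC_ell2 c (delta k)"

lemma ell2_fun_basis: "ell2_fun (basis_ell2 c k) j = (if j = k then c else 0)"
  by (simp add: scaleC_ell2.rep_eq delta.rep_eq)

lemma ell2_fun_finite_combination:
  assumes "finite F"
  shows "ell2_fun (\<Sum>k\<in>F. basis_ell2 (c k) k) j = (if j \<in> F then c j else 0)"
  using assms by (simp add: ell2_fun_sum ell2_fun_basis)

lemma norm_finite_combination:
  assumes "finite F"
  shows "(norm (\<Sum>k\<in>F. basis_ell2 (c k) k))\<^sup>2 = (\<Sum>k\<in>F. (cmod (c k))\<^sup>2)"
proof -
  have "((\<lambda>j. (cmod (if j \<in> F then c j else 0))\<^sup>2) has_sum (\<Sum>k\<in>F. (cmod (c k))\<^sup>2)) UNIV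
    \<longleftrightarrow> ((\<lambda>k. (cmod (c k))\<^sup>2) has_sum (\<Sum>k\<in>F. (cmod (c k))\<^sup>2)) F"
    by (rule has_sum_cong_neutral) auto
  then show ?thesis
    using has_sum_norm_ell2[of "\<Sum>k\<in>F. basis_ell2 (c k) k"] assms
    by (simp add: ell2_fun_finite_combination has_sum_finite has_sum_unique)
qed

text \<open>The partial sum over F agrees with f on F and vanishes elsewhere, so by Pythagoras the
  squared error is the tail of the convergent series of squares.\<close>

lemma has_sum_basis_ell2: "((\<lambda>k. basis_ell2 (ell2_fun f k) k) has_sum f) UNIV"
proof -
  define S where "S F = (\<Sum>k\<in>F. basis_ell2 (ell2_fun f k) k)" for F
  have eq: "(norm (S F - f))\<^sup>2 = (norm f)\<^sup>2 - (\<Sum>k\<in>F. (cmod (ell2_fun f k))\<^sup>2)" if "finite F" for F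
  proof -
    have "ell2_fun (S F - f) k = ell2_fun (S F) k - ell2_fun f k" for k
      by (simp add: minus_ell2.rep_eq)
    then have "(cmod (ell2_fun (S F - f) k))\<^sup>2 + (cmod (ell2_fun (S F) k))\<^sup>2 = (cmod (ell2_fun f
        k))\<^sup>2" for k
      using that by (simp add: S_def ell2_fun_finite_combination)
    then have "((\<lambda>k. (cmod (ell2_fun f k))\<^sup>2) has_sum (norm (S F - f))\<^sup>2 + (norm (S F))\<^sup>2) UNIV"
      using has_sum_add[OF has_sum_norm_ell2[of "S F - f"] has_sum_norm_ell2[of "S F"]] by simp
    from has_sum_unique[OF this has_sum_norm_ell2] show ?thesis
      using that by (simp add: S_def norm_finite_combination)
  qed
  have "((\<lambda>F. (norm f)\<^sup>2 - (\<Sum>k\<in>F. (cmod (ell2_fun f k))\<^sup>2)) \<longlongrightarrow> (norm f)\<^sup>2 - (norm f)\<^sup>2)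
      (finite_subsets_at_top UNIV)"
    using has_sum_norm_ell2[of f] unfolding has_sum_def by (intro tendsto_intros)
  moreover have "\<forall>\<^sub>F F in finite_subsets_at_top UNIV.
      (norm f)\<^sup>2 - (\<Sum>k\<in>F. (cmod (ell2_fun f k))\<^sup>2) = (norm (S F - f))\<^sup>2"
    by (rule eventually_finite_subsets_at_top_weakI) (simp add: eq)
  ultimately have "((\<lambda>F. (norm (S F - f))\<^sup>2) \<longlongrightarrow> (norm f)\<^sup>2 - (norm f)\<^sup>2) (finite_subsets_at_top
      UNIV)"
    by (rule Lim_transform_eventually)
  then have "((\<lambda>F. sqrt ((norm (S F - f))\<^sup>2)) \<longlongrightarrow> sqrt ((norm f)\<^sup>2 - (norm f)\<^sup>2))
      (finite_subsets_at_top UNIV)"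
    by (intro tendsto_intros)
  then show ?thesis
    unfolding has_sum_def S_def[symmetric] by (simp add: tendsto_norm_zero_iff LIM_zero_iff)
qed

lemma op_eqI:
  assumes "\<And>c h k. ell2_fun (blinfun_apply x (basis_ell2 c h)) k = ell2_fun (blinfun_apply y
      (basis_ell2 c h)) k"
  shows "x = y"
proof (rule blinfun_eqI)
  fix f
  have eq: "x (basis_ell2 c h) = y (basis_ell2 c h)" for c h
    by (rule ell2_eqI) (rule assms)
  show "x f = y f"
    using has_sum_bounded_linear[OF blinfun.bounded_linear_right has_sum_basis_ell2, of x f]
      has_sum_bounded_linear[OF blinfun.bounded_linear_right has_sum_basis_ell2, of y f]
    by (auto simp: eq o_def dest: has_sum_unique)
qed

section \<open>Positive semidefinite kernels\<close>

text \<open>For a real symmetric kernel real weights suffice: the Hermitian form at a + i b is the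
  sum of the forms at a and at b.\<close>

definition psd_on :: "'a set \<Rightarrow> ('a \<Rightarrow> 'a \<Rightarrow> real) \<Rightarrow> bool"
  where "psd_on F K \<longleftrightarrow> (\<forall>i\<in>F. \<forall>j\<in>F. K i j = K j i)
    \<and> (\<forall>c. 0 \<le> (\<Sum>i\<in>F. \<Sum>j\<in>F. c i * c j * K i j))"

text \<open>Cholesky factorization by induction on F: the new point a serves as pivot, a rank-one
  kernel carrying its row is subtracted, and the Schur complement that remains on F is again
  positive semidefinite.\<close>

lemma psd_on_factorization:
  assumes "finite F" and "psd_on F K"
  shows "\<exists>\<xi>. \<forall>i\<in>F. \<forall>j\<in>F. K i j = (\<Sum>m\<in>F. \<xi> m i * \<xi> m j :: real)"
  using assms
proof (induction F arbitrary: K rule: finite_induct)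
  case (insert a F)
  have sym: "K i j = K j i" if "i \<in> insert a F" "j \<in> insert a F" for i j
    using insert.prems that unfolding psd_on_def by blast
  define L where "L c = (\<Sum>i\<in>F. c i * K i a)" for c
  have quad: "0 \<le> (\<Sum>i\<in>F. \<Sum>j\<in>F. c i * c j * K i j) + 2 * s * L c + s\<^sup>2 * K a a" for c s
  proof -
    have "0 \<le> (\<Sum>i\<in>insert a F. \<Sum>j\<in>insert a F. (c(a := s)) i * (c(a := s)) j * K i j)"
      using insert.prems unfolding psd_on_def by blast
    also have "\<dots> = s * s * K a a + (\<Sum>j\<in>F. s * c j * K a j)
        + (\<Sum>i\<in>F. c i * s * K i a + (\<Sum>j\<in>F. c i * c j * K i j))"
    proof -
      have "i \<in> F \<Longrightarrow> (c(a := s)) i = c i" for i using insert.hyps by auto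
      then show ?thesis using insert.hyps by (simp cong: sum.cong)
    qed
    also have "(\<Sum>j\<in>F. s * c j * K a j) = s * L c"
      unfolding L_def sum_distrib_left by (rule sum.cong) (auto simp: sym)
    also have "(\<Sum>i\<in>F. c i * s * K i a + (\<Sum>j\<in>F. c i * c j * K i j))
        = s * L c + (\<Sum>i\<in>F. \<Sum>j\<in>F. c i * c j * K i j)"
      by (simp add: sum.distrib L_def sum_distrib_left mult_ac)
    finally show ?thesis by (simp add: power2_eq_square algebra_simps)
  qed
  have nonneg: "0 \<le> K a a" using quad[of "\<lambda>_. 0" 1] by (simp add: L_def)
  \<comment> \<open>A zero pivot forces a zero row, as otherwise the form would be affine and
    nonconstant in s.\<close>
  have row: "K j a = 0" if "K a a = 0" "j \<in> F" for j
  proof (rule ccontr)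
    assume nz: "K j a \<noteq> 0"
    let ?c = "\<lambda>i. if i = j then 1 else 0 :: real"
    have "L ?c = K j a" using that insert.hyps
      by (simp add: L_def if_distrib[where f = "\<lambda>x. x * _"] cong: if_cong)
    moreover have "(\<Sum>i\<in>F. \<Sum>l\<in>F. ?c i * ?c l * K i l) = K j j"
    proof -
      have "(\<Sum>l\<in>F. ?c i * ?c l * K i l) = (if i = j then K j j else 0)" for i
        using that insert.hyps by (simp add: if_distrib[where f = "\<lambda>x. x * _"] cong: if_cong)
      then show ?thesis using that insert.hyps by simp
    qed
    \<comment> \<open>This s makes the form equal to -1.\<close>
    ultimately show False
      using quad[of ?c "- (K j j + 1) / (2 * K j a)"] that nz
      by (simp add: field_simps)
  qed
  \<comment> \<open>For a zero pivot the division by zero yields \<eta> = 0, which fits the zero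
    row.\<close>
  define \<eta> where "\<eta> i = K i a / sqrt (K a a)" for i
  have "psd_on F (\<lambda>i j. K i j - \<eta> i * \<eta> j)"
    unfolding psd_on_def
  proof (intro conjI ballI allI)
    fix c :: "_ \<Rightarrow> real"
    have "(\<Sum>i\<in>F. \<Sum>j\<in>F. c i * c j * (K i j - \<eta> i * \<eta> j))
      = (\<Sum>i\<in>F. \<Sum>j\<in>F. c i * c j * K i j) - (\<Sum>i\<in>F. c i * \<eta> i) * (\<Sum>j\<in>F. c j * \<eta> j)"
      by (simp add: sum_product sum_subtractf right_diff_distrib mult_ac)
    moreover have "(\<Sum>i\<in>F. c i * \<eta> i) = L c / sqrt (K a a)"
      by (simp add: L_def \<eta>_def sum_divide_distrib)
    \<comment> \<open>The value s = - L c / K a a minimizes the quadratic polynomial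
      \<open>quad\<close>; for a zero pivot the subtracted term is 0.\<close>
    moreover have "0 \<le> (\<Sum>i\<in>F. \<Sum>j\<in>F. c i * c j * K i j) - L c * L c / K a a"
    proof (cases "K a a = 0")
      case True then show ?thesis using quad[of c 0] by simp
    next
      case False then show ?thesis using quad[of c "- L c / K a a"]
        by (simp add: power2_eq_square)
    qed
    ultimately show "0 \<le> (\<Sum>i\<in>F. \<Sum>j\<in>F. c i * c j * (K i j - \<eta> i * \<eta> j))"
      using nonneg by simp
  qed (use sym in auto)
  from insert.IH[OF this] obtain \<xi>
    where \<xi>: "\<And>i j. i \<in> F \<Longrightarrow> j \<in> F \<Longrightarrow> K i j - \<eta> i * \<eta> j = (\<Sum>m\<in>F. \<xi> m i * \<xi> m j)" by blast
  have eta_a: "K i a = \<eta> i * \<eta> a" if "i \<in> insert a F" for i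
    using that row nonneg by (cases "K a a = 0") (auto simp: \<eta>_def)
  \<comment> \<open>The vectors obtained on F are padded with 0 at a, and \<eta> becomes the vector
    with index a.\<close>
  define \<zeta> where "\<zeta> m i = (if m = a then \<eta> i else if i = a then 0 else \<xi> m i)" for m i
  have "K i j = (\<Sum>m\<in>insert a F. \<zeta> m i * \<zeta> m j)" if "i \<in> insert a F" "j \<in> insert a F" for i j
  proof -
    have "(\<Sum>m\<in>F. \<zeta> m i * \<zeta> m j) = (\<Sum>m\<in>F. if i = a \<or> j = a then 0 else \<xi> m i * \<xi> m j)"
      using insert.hyps by (intro sum.cong) (auto simp: \<zeta>_def)
    then have "(\<Sum>m\<in>insert a F. \<zeta> m i * \<zeta> m j)
      = \<eta> i * \<eta> j + (if i = a \<or> j = a then 0 else (\<Sum>m\<in>F. \<xi> m i * \<xi> m j))"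
      using insert.hyps by (simp add: \<zeta>_def)
    also have "\<dots> = K i j"
      using that eta_a[of i] eta_a[of j] \<xi>[of i j] sym[of i j] by (auto simp: mult.commute)
    finally show ?thesis by simp
  qed
  then show ?case by blast
qed simp

text \<open>Schur's product theorem: after factoring K, the form of the product at c is the sum over
  m of the forms of L at the weights \<open>c i * \<xi> m i\<close>.\<close>

lemma psd_on_mult:
  assumes "finite F" "psd_on F K" "psd_on F L"
  shows "psd_on F (\<lambda>i j. K i j * L i j)"
  unfolding psd_on_def
proof (intro conjI ballI allI)
  fix c :: "_ \<Rightarrow> real"
  obtain \<xi> where \<xi>: "\<And>i j. i \<in> F \<Longrightarrow> j \<in> F \<Longrightarrow> K i j = (\<Sum>m\<in>F. \<xi> m i * \<xi> m j)"
    using psd_on_factorization[OF assms(1,2)] by blast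
  have "(\<Sum>i\<in>F. \<Sum>j\<in>F. c i * c j * (K i j * L i j))
    = (\<Sum>i\<in>F. \<Sum>j\<in>F. \<Sum>m\<in>F. (c i * \<xi> m i) * (c j * \<xi> m j) * L i j)"
    by (intro sum.cong refl) (simp add: \<xi> sum_distrib_left sum_distrib_right mult_ac)
  also have "\<dots> = (\<Sum>m\<in>F. \<Sum>i\<in>F. \<Sum>j\<in>F. (c i * \<xi> m i) * (c j * \<xi> m j) * L i j)"
    by (subst (2) sum.swap) (subst sum.swap, rule refl)
  also have "\<dots> \<ge> 0"
    by (rule sum_nonneg) (use assms(3) in \<open>simp add: psd_on_def\<close>)
  finally show "0 \<le> (\<Sum>i\<in>F. \<Sum>j\<in>F. c i * c j * (K i j * L i j))" .
qed (use assms in \<open>auto simp: psd_on_def\<close>)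

lemma psd_on_rank_one: "psd_on F (\<lambda>i j. a i * a j)"
proof -
  have "(\<Sum>i\<in>F. \<Sum>j\<in>F. c i * c j * (a i * a j)) = (\<Sum>i\<in>F. c i * a i)\<^sup>2" for c
    by (simp add: power2_eq_square sum_product mult_ac)
  then show ?thesis by (simp add: psd_on_def)
qed

lemma psd_on_add:
  assumes "psd_on F K" "psd_on F L"
  shows "psd_on F (\<lambda>i j. K i j + L i j)"
  using assms unfolding psd_on_def by (simp add: distrib_left sum.distrib)

text \<open>Entrywise powers are positive semidefinite by Schur's theorem, the power series has
  nonnegative coefficients, and positivity survives the limit.\<close>

lemma psd_on_exp:
  assumes "finite F" and K: "psd_on F K"
  shows "psd_on F (\<lambda>i j. exp (K i j))"
proof -
  have pow: "psd_on F (\<lambda>i j. K i j ^ n / fact n)" for n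
  proof (induction n)
    case 0
    show ?case using psd_on_rank_one[of F "\<lambda>_. 1"] by simp
  next
    case (Suc n)
    \<comment> \<open>The constant rank-one kernel 1 / (n + 1), written with a square root, turns
      the factorial of n into that of n + 1.\<close>
    show ?case
      using psd_on_mult[OF assms(1) psd_on_rank_one[of F "\<lambda>_. sqrt (1 / (1 + real n))"]
          psd_on_mult[OF assms(1) K Suc]] by simp
  qed
  have partial: "psd_on F (\<lambda>i j. \<Sum>m<n. K i j ^ m / fact m)" for n
  proof (induction n)
    case 0
    show ?case using psd_on_rank_one[of F "\<lambda>_. 0"] by simp
  next
    case (Suc n)
    show ?case using psd_on_add[OF Suc pow] by simp
  qed
  show ?thesis
    unfolding psd_on_def
  proof (intro conjI ballI allI)
    fix c :: "_ \<Rightarrow> real"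
    have "(\<lambda>n. \<Sum>m<n. K i j ^ m / fact m) \<longlonglongrightarrow> exp (K i j)" for i j
      using exp_converges[of "K i j"] by (simp add: sums_def divide_inverse_commute)
    then have "(\<lambda>n. \<Sum>i\<in>F. \<Sum>j\<in>F. c i * c j * (\<Sum>m<n. K i j ^ m / fact m))
      \<longlonglongrightarrow> (\<Sum>i\<in>F. \<Sum>j\<in>F. c i * c j * exp (K i j))"
      by (intro tendsto_intros)
    then show "0 \<le> (\<Sum>i\<in>F. \<Sum>j\<in>F. c i * c j * exp (K i j))"
      by (rule LIMSEQ_le_const) (use partial in \<open>auto simp: psd_on_def\<close>)
  qed (use K in \<open>auto simp: psd_on_def\<close>)
qed

text \<open>Adjoining the neutral element with weight -S, where S is the sum of the weights, makes
  the total weight zero. As d vanishes there, negative definiteness reads Q - 2 S T \<le> 0, with Q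
  the form of d(i - j) and T the weighted sum of d; the claim is 2 S T - Q \<ge> 0. The points need
  not be distinct, so F may already contain the neutral element.\<close>

lemma ND0_psd_on:
  assumes "d \<in> ND0" "finite F"
  shows "psd_on F (\<lambda>i j. d i + d j - d (i - j))"
  unfolding psd_on_def
proof (intro conjI ballI allI)
  have sym: "d (- g) = d g" and d0: "d 0 = 0" for g using assms(1) unfolding ND0_def by blast+
  have nd: "(\<Sum>i<n. \<Sum>j<n. b i * b j * d (- g i + g j)) \<le> 0"
    if "(\<Sum>i<n. b i) = 0" for n and b :: "nat \<Rightarrow> real" and g
  proof -
    have "(\<Sum>i<n. complex_of_real (b i)) = 0" using that by (simp flip: of_real_sum)
    then have "(\<Sum>i<n. \<Sum>j<n. cnj (complex_of_real (b i)) * complex_of_real (b j) * of_real (d (- g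
        i + g j))) \<in> \<real>\<^sub>\<le>\<^sub>0"
      using assms(1) unfolding ND0_def by blast
    then have "complex_of_real (\<Sum>i<n. \<Sum>j<n. b i * b j * d (- g i + g j)) \<in> \<real>\<^sub>\<le>\<^sub>0"
      by simp
    then show ?thesis by (simp only: nonpos_Reals_of_real_iff)
  qed
  fix c :: "_ \<Rightarrow> real"
  obtain e where e: "bij_betw e {..<card F} F"
    using ex_bij_betw_nat_finite[OF assms(2)] atLeast0LessThan by metis
  define n where "n = card F"
  define b where "b i = (if i < n then c (e i) else - (\<Sum>i<n. c (e i)))" for i
  \<comment> \<open>The sign converts the difference \<open>- g i + g j\<close> of
    \<open>ND0\<close> into \<open>e i - e j\<close>.\<close>
  define g where "g i = (if i < n then - e i else 0)" for i
  have re: "(\<Sum>i\<in>F. f i) = (\<Sum>i<n. f (e i))" for f :: "_ \<Rightarrow> real"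
    using sum.reindex_bij_betw[OF e, of f] by (simp add: n_def)
  define S where "S = (\<Sum>i<n. c (e i))"
  define T where "T = (\<Sum>i<n. c (e i) * d (e i))"
  define Q where "Q = (\<Sum>i<n. \<Sum>j<n. c (e i) * c (e j) * d (e i - e j))"
  have "(\<Sum>i<Suc n. b i) = 0" by (simp add: b_def)
  from nd[OF this, of g]
  have "(\<Sum>i<n. (\<Sum>j<n. c (e i) * c (e j) * d (e i - e j)) + c (e i) * - S * d (e i))
      + (\<Sum>j<n. - S * c (e j) * d (e j)) \<le> 0"
    by (simp add: b_def g_def d0 sym S_def)
  moreover have "(\<Sum>i<n. (\<Sum>j<n. c (e i) * c (e j) * d (e i - e j)) + c (e i) * - S * d (e i))
    = Q - S * T"
    unfolding Q_def T_def sum.distrib sum_distrib_left by (simp add: sum_negf mult_ac)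
  moreover have "(\<Sum>j<n. - S * c (e j) * d (e j)) = - (S * T)"
    unfolding T_def sum_distrib_left by (simp add: sum_negf mult_ac)
  ultimately have "Q - S * T - S * T \<le> 0" by linarith
  moreover have "(\<Sum>i\<in>F. \<Sum>j\<in>F. c i * c j * (d i + d j - d (i - j))) = S * T + S * T - Q"
  proof -
    have "(\<Sum>i\<in>F. \<Sum>j\<in>F. c i * c j * (d i + d j - d (i - j)))
      = (\<Sum>i<n. \<Sum>j<n. (c (e i) * d (e i)) * c (e j)) + (\<Sum>i<n. \<Sum>j<n. c (e i) * (c (e j) * d (e j)))
          - Q"
      unfolding re Q_def by (simp add: algebra_simps sum.distrib sum_subtractf)
    also have "\<dots> = T * S + S * T - Q" unfolding S_def T_def sum_product by simp
    finally show ?thesis by simp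
  qed
  ultimately show "0 \<le> (\<Sum>i\<in>F. \<Sum>j\<in>F. c i * c j * (d i + d j - d (i - j)))" by linarith
next
  fix i j
  have "d (- (i - j)) = d (i - j)" using assms(1) unfolding ND0_def by blast
  then show "d i + d j - d (i - j) = d j + d i - d (j - i)" by simp
qed

text \<open>The kernel is taken at \<open>i - j\<close>, not at \<open>- i + j\<close>, because the
  matrix entry (k, h) of an element of \<open>Cr \<sigma>\<close> involves the Fourier coefficient
  at \<open>k - h\<close>.\<close>

definition pos_def_fun :: "('g::group_add \<Rightarrow> real) \<Rightarrow> bool"
  where "pos_def_fun \<phi> \<longleftrightarrow> (\<forall>F. finite F \<longrightarrow> psd_on F (\<lambda>i j. \<phi> (i - j)))"

text \<open>Schoenberg's theorem: \<open>exp (- t d(i - j))\<close> is the entrywise exponential of a positive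
  semidefinite kernel, rescaled by \<open>exp (- t d(i)) exp (- t d(j))\<close>.\<close>

lemma pos_def_fun_exp_ND0:
  assumes "d \<in> ND0" "t \<ge> 0"
  shows "pos_def_fun (\<lambda>g. exp (- t * d g))"
  unfolding pos_def_fun_def
proof (intro allI impI)
  fix F :: "'a set" assume F: "finite F"
  have "psd_on F (\<lambda>i j. exp (sqrt t * sqrt t * (d i + d j - d (i - j))))"
    by (intro psd_on_exp psd_on_mult ND0_psd_on psd_on_rank_one F assms)
  from psd_on_mult[OF F psd_on_rank_one[of F "\<lambda>i. exp (- t * d i)"] this]
  show "psd_on F (\<lambda>i j. exp (- t * d (i - j)))"
    using assms(2) by (simp add: algebra_simps flip: exp_add)
qed

section \<open>Positive definite multipliers\<close>

lemma inner_basis_ell2: "z \<bullet> basis_ell2 c k = ell2_fun z k \<bullet> c"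
proof -
  have "(\<Sum>\<^sub>\<infinity>j. ell2_fun z j \<bullet> (if j = k then c else 0)) = (\<Sum>\<^sub>\<infinity>j\<in>{k}. ell2_fun z j \<bullet> c)"
    by (rule infsum_cong_neutral) auto
  then show ?thesis by (simp add: inner_ell2_def ell2_fun_basis)
qed

lemma scaleR_basis_ell2: "r *\<^sub>R basis_ell2 c k = basis_ell2 (of_real r * c) k"
  by (rule ell2_eqI) (simp add: scaleR_ell2.rep_eq ell2_fun_basis)

text \<open>Factoring the kernel \<open>\<phi>(k - h)\<close> as \<open>\<Sum>\<^sub>m \<xi>\<^sub>m(k) \<xi>\<^sub>m(h)\<close> turns the sesquilinear form of \<open>y\<close>
  into the sum over \<open>m\<close> of the form of \<open>x\<close> at the vectors \<open>\<xi>\<^sub>m f\<close> and \<open>\<xi>\<^sub>m g\<close>, whose square norms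
  sum up to those of \<open>f\<close> and \<open>g\<close>.\<close>

lemma norm_le_of_pos_def_multiplier:
  fixes x y :: "'g::group_add op"
  assumes pd: "pos_def_fun \<phi>" and one: "\<phi> 0 = 1"
    and y: "\<And>c h k. ell2_fun (y (basis_ell2 c h)) k = of_real (\<phi> (k - h)) * ell2_fun (x
        (basis_ell2 c h)) k"
  shows "norm y \<le> norm x"
proof -
  define P where "P F f = (\<Sum>k\<in>F. basis_ell2 (f k) k)" for F and f :: "'g \<Rightarrow> complex"
  \<comment> \<open>The mean of the two squared norms, unlike the product of the norms, is additive
    over the index m of the factorization.\<close>
  have fin: "y (P F f) \<bullet> P F g \<le> norm x * (((norm (P F f))\<^sup>2 + (norm (P F g))\<^sup>2) / 2)"
    if F: "finite F" for F f g
  proof -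
    obtain \<xi> where \<xi>: "\<And>i j. i \<in> F \<Longrightarrow> j \<in> F \<Longrightarrow> \<phi> (i - j) = (\<Sum>m\<in>F. \<xi> m i * \<xi> m j)"
      using psd_on_factorization[OF F, of "\<lambda>i j. \<phi> (i - j)"] pd F unfolding pos_def_fun_def by blast
    define Q where "Q f m = P F (\<lambda>k. of_real (\<xi> m k) * f k)" for f :: "'g \<Rightarrow> complex" and m
    have Q: "(\<Sum>m\<in>F. (norm (Q f m))\<^sup>2) = (norm (P F f))\<^sup>2" for f
    proof -
      have "(\<Sum>m\<in>F. (norm (Q f m))\<^sup>2) = (\<Sum>m\<in>F. \<Sum>k\<in>F. (\<xi> m k)\<^sup>2 * (cmod (f k))\<^sup>2)"
        by (simp add: Q_def P_def norm_finite_combination[OF F] norm_mult power_mult_distrib)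
      \<comment> \<open>The diagonal of the factorization gives the sum of the squares of
        \<open>\<xi> m k\<close> over m, namely \<phi> 0 = 1; \<open>k - k\<close> must stay
        unsimplified for \<xi> to apply.\<close>
      also have "\<dots> = (\<Sum>k\<in>F. \<phi> (k - k) * (cmod (f k))\<^sup>2)"
        by (subst sum.swap) (simp add: \<xi> sum_distrib_right power2_eq_square del: diff_self)
      finally show ?thesis by (simp add: one P_def norm_finite_combination[OF F])
    qed
    define B where "B h k = x (basis_ell2 (f h) h) \<bullet> basis_ell2 (g k) k" for h k
    have "y (P F f) \<bullet> P F g = (\<Sum>h\<in>F. \<Sum>k\<in>F. y (basis_ell2 (f h) h) \<bullet> basis_ell2 (g k) k)"
      unfolding P_def blinfun.sum_right inner_sum_left by (simp add: inner_sum_right)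
    also have "\<dots> = (\<Sum>h\<in>F. \<Sum>k\<in>F. \<phi> (k - h) * B h k)"
      by (simp add: inner_basis_ell2 y B_def flip: scaleR_conv_of_real del: inner_complex_def)
    also have "\<dots> = (\<Sum>h\<in>F. \<Sum>k\<in>F. \<Sum>m\<in>F. \<xi> m h * \<xi> m k * B h k)"
      by (intro sum.cong refl) (simp add: \<xi> sum_distrib_left mult_ac)
    also have "\<dots> = (\<Sum>m\<in>F. \<Sum>h\<in>F. \<Sum>k\<in>F. \<xi> m h * \<xi> m k * B h k)"
      by (subst (2) sum.swap) (subst sum.swap, rule refl)
    also have "\<dots> = (\<Sum>m\<in>F. x (Q f m) \<bullet> Q g m)"
    proof (rule sum.cong[OF refl])
      fix m
      show "(\<Sum>h\<in>F. \<Sum>k\<in>F. \<xi> m h * \<xi> m k * B h k) = x (Q f m) \<bullet> Q g m"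
        unfolding Q_def P_def B_def scaleR_basis_ell2[symmetric] blinfun.sum_right inner_sum_left
        by (simp add: inner_sum_right blinfun.scaleR_right mult_ac)
    qed
    also have "\<dots> \<le> (\<Sum>m\<in>F. norm x * (((norm (Q f m))\<^sup>2 + (norm (Q g m))\<^sup>2) / 2))"
    proof (rule sum_mono)
      fix m
      have "x (Q f m) \<bullet> Q g m \<le> norm (x (Q f m)) * norm (Q g m)" by (rule norm_cauchy_schwarz)
      also have "\<dots> \<le> norm x * norm (Q f m) * norm (Q g m)"
        by (intro mult_right_mono norm_blinfun) simp
      also have "\<dots> = norm x * (norm (Q f m) * norm (Q g m))" by simp
      also have "\<dots> \<le> norm x * (((norm (Q f m))\<^sup>2 + (norm (Q g m))\<^sup>2) / 2)"
        using sum_squares_bound[of "norm (Q f m)" "norm (Q g m)"] by (intro mult_left_mono) auto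
      finally show "x (Q f m) \<bullet> Q g m \<le> norm x * (((norm (Q f m))\<^sup>2 + (norm (Q g m))\<^sup>2) / 2)" .
    qed
    also have "\<dots> = norm x * (((norm (P F f))\<^sup>2 + (norm (P F g))\<^sup>2) / 2)"
      unfolding Q[symmetric] by (simp add: sum_distrib_left sum.distrib sum_divide_distrib
          distrib_left add_divide_distrib)
    finally show ?thesis .
  qed
  have lim: "y f \<bullet> g \<le> norm x * (((norm f)\<^sup>2 + (norm g)\<^sup>2) / 2)" for f g
  proof (rule tendsto_le[where F = "finite_subsets_at_top UNIV"])
    have "((\<lambda>F. P F (ell2_fun f)) \<longlongrightarrow> f) (finite_subsets_at_top UNIV)" for f
      using has_sum_basis_ell2[of f] by (simp add: has_sum_def P_def)
    then show "((\<lambda>F. y (P F (ell2_fun f)) \<bullet> P F (ell2_fun g)) \<longlongrightarrow> y f \<bullet> g) (finite_subsets_at_top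
        UNIV)"
      and "((\<lambda>F. norm x * (((norm (P F (ell2_fun f)))\<^sup>2 + (norm (P F (ell2_fun g)))\<^sup>2) / 2))
        \<longlongrightarrow> norm x * (((norm f)\<^sup>2 + (norm g)\<^sup>2) / 2)) (finite_subsets_at_top UNIV)"
      by (intro tendsto_intros; simp)+
    show "\<forall>\<^sub>F F in finite_subsets_at_top UNIV. y (P F (ell2_fun f)) \<bullet> P F (ell2_fun g)
        \<le> norm x * (((norm (P F (ell2_fun f)))\<^sup>2 + (norm (P F (ell2_fun g)))\<^sup>2) / 2)"
      by (rule eventually_finite_subsets_at_top_weakI) (rule fin)
  qed simp
  show ?thesis
  proof (rule norm_blinfun_bound)
    fix f
    show "norm (y f) \<le> norm x * norm f"
    proof (cases "norm f = 0 \<or> norm (y f) = 0")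
      case True
      then show ?thesis by (auto simp: blinfun.zero_right)
    next
      case False
      \<comment> \<open>Rescaling to norm g = norm f makes the mean of the squares equal to the
        product of the norms.\<close>
      define g where "g = (norm f / norm (y f)) *\<^sub>R y f"
      have "norm g = norm f" using False by (simp add: g_def)
      moreover have "y f \<bullet> g = norm f * norm (y f)"
        using False by (simp add: g_def power2_norm_eq_inner[symmetric] power2_eq_square)
      ultimately have "norm f * norm (y f) \<le> norm f * (norm x * norm f)"
        using lim[of f g] by (simp add: power2_eq_square mult_ac)
      then show ?thesis using False by simp
    qed
  qed simp
qed

section \<open>Fourier coefficients\<close>

lemma bounded_linear_blinfun_coeff: "bounded_linear (\<lambda>x :: 'a op. ell2_fun (x f) k)"
  using bounded_linear_compose[OF bounded_linear_ell2_fun blinfun.bounded_linear_left] .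

lemma bounded_linear_fourier_coeff: "bounded_linear (\<lambda>x. fourier_coeff x g)"
  unfolding fourier_coeff_def by (rule bounded_linear_blinfun_coeff)

lemma fourier_coeff_scaleC: "fourier_coeff (c *\<^sub>C x) g = c * fourier_coeff x g"
  by (simp add: fourier_coeff_def scaleC_op_apply scaleC_ell2.rep_eq)

lemma scaleC_op_of_real: "of_real r *\<^sub>C x = r *\<^sub>R x"
  by (rule op_eqI) (simp add: scaleC_op_apply scaleC_ell2.rep_eq blinfun.scaleR_left
      scaleR_ell2.rep_eq)

lemma scaleC_op_assoc: "a *\<^sub>C (b *\<^sub>C x) = (a * b) *\<^sub>C x"
  by (rule op_eqI) (simp add: scaleC_op_apply scaleC_ell2.rep_eq)

lemma scaleC_op_add_right: "c *\<^sub>C (x + y) = c *\<^sub>C x + c *\<^sub>C y"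
  by (rule op_eqI) (simp add: scaleC_op_apply scaleC_ell2.rep_eq blinfun.add_left plus_ell2.rep_eq
      distrib_left)

lemma scaleC_op_add_left: "(a + b) *\<^sub>C x = a *\<^sub>C x + b *\<^sub>C x"
  by (rule op_eqI) (simp add: scaleC_op_apply scaleC_ell2.rep_eq blinfun.add_left plus_ell2.rep_eq
      distrib_right)

lemma scaleC_op_zero_right: "c *\<^sub>C (0 :: 'a op) = 0"
  by (rule op_eqI) (simp add: scaleC_op_apply scaleC_ell2.rep_eq zero_ell2.rep_eq)

lemma scaleC_op_zero_left: "0 *\<^sub>C x = 0"
  by (rule op_eqI) (simp add: scaleC_op_apply scaleC_ell2.rep_eq zero_ell2.rep_eq)

lemma scaleC_op_sum_right: "c *\<^sub>C (\<Sum>i\<in>F. x i) = (\<Sum>i\<in>F. c *\<^sub>C x i)"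
  by (induction F rule: infinite_finite_induct) (auto simp: scaleC_op_zero_right
      scaleC_op_add_right)

lemma bounded_linear_scaleC_op: "bounded_linear (\<lambda>x. c *\<^sub>C x)"
  unfolding scaleC_op_def by (rule bounded_linear_intros) simp

lemma fourier_coeff_Lam: "\<sigma> \<in> Z2 \<Longrightarrow> fourier_coeff (Lam \<sigma> g) k = (if k = g then 1 else 0)"
  by (simp add: fourier_coeff_def Lam_delta scaleC_ell2.rep_eq delta.rep_eq Z2_def)

lemma fourier_coeff_sum_Lam:
  assumes "\<sigma> \<in> Z2" "finite F"
  shows "fourier_coeff (\<Sum>g\<in>F. a g *\<^sub>C Lam \<sigma> g) k = (if k \<in> F then a k else 0)"
  by (simp add: linear_sum[OF bounded_linear.linear[OF bounded_linear_fourier_coeff]] assms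
      fourier_coeff_scaleC fourier_coeff_Lam if_distrib cong: if_cong)

section \<open>The closed linear span of the operators \<open>Lam \<sigma> g\<close>\<close>

lemma Cr_span: "finite F \<Longrightarrow> (\<Sum>g\<in>F. a g *\<^sub>C Lam \<sigma> g) \<in> Cr \<sigma>"
  unfolding Cr_def by (rule subsetD[OF closure_subset]) blast

text \<open>Suited to conditions that are closed in the whole operator space, such as identities
  between continuous maps.\<close>

lemma Cr_closure_induct [consumes 1, case_names span lim]:
  assumes "x \<in> Cr \<sigma>"
    and "\<And>a F. finite F \<Longrightarrow> P (\<Sum>g\<in>F. a g *\<^sub>C Lam \<sigma> g)"
    and "closed {x. P x}"
  shows "P x"
proof -
  have "Cr \<sigma> \<subseteq> {x. P x}"
    unfolding Cr_def by (rule closure_minimal) (use assms in auto)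
  then show ?thesis using assms(1) by blast
qed

lemma Cr_approx:
  assumes "x \<in> Cr \<sigma>"
  obtains a F where "\<And>n. finite (F n)" "(\<lambda>n. \<Sum>g\<in>F n. a n g *\<^sub>C Lam \<sigma> g) \<longlonglongrightarrow> x"
proof -
  obtain s where s: "\<And>n. s n \<in> {\<Sum>g\<in>F. a g *\<^sub>C Lam \<sigma> g | a F. finite F}" and lim: "s \<longlonglongrightarrow> x"
    using assms unfolding Cr_def closure_sequential by blast
  from s have "\<forall>n. \<exists>a F. s n = (\<Sum>g\<in>F. a g *\<^sub>C Lam \<sigma> g) \<and> finite F" by blast
  then obtain a F where aF: "\<And>n. s n = (\<Sum>g\<in>F n. a n g *\<^sub>C Lam \<sigma> g)" "\<And>n. finite (F n)" by metis
  then have "s = (\<lambda>n. \<Sum>g\<in>F n. a n g *\<^sub>C Lam \<sigma> g)" by blast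
  then show thesis using that[of F a] aF lim by simp
qed

lemma closed_Cr: "closed (Cr \<sigma>)"
  by (simp add: Cr_def)

lemma Cr_scaleC: "x \<in> Cr \<sigma> \<Longrightarrow> c *\<^sub>C x \<in> Cr \<sigma>"
proof (induction rule: Cr_closure_induct)
  case (span a F)
  then show ?case by (simp add: scaleC_op_sum_right scaleC_op_assoc Cr_span)
next
  case lim
  have "closed ((\<lambda>x. c *\<^sub>C x) -` Cr \<sigma>)"
    by (intro continuous_closed_vimage closed_Cr) (simp add: bounded_linear_scaleC_op
        linear_continuous_at)
  then show ?case by (simp add: vimage_def)
qed

lemma Cr_Lam: "Lam \<sigma> g \<in> Cr \<sigma>"
  using Cr_span[of "{g}" "\<lambda>_. 1" \<sigma>] scaleC_op_of_real[of 1 "Lam \<sigma> g"] by simp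

lemma span_add:
  assumes "finite F" "finite G"
  shows "(\<Sum>g\<in>F. a g *\<^sub>C Lam \<sigma> g) + (\<Sum>g\<in>G. b g *\<^sub>C Lam \<sigma> g)
    = (\<Sum>g\<in>F \<union> G. ((if g \<in> F then a g else 0) + (if g \<in> G then b g else 0)) *\<^sub>C Lam \<sigma> g)"
proof -
  have "(\<Sum>g\<in>F. a g *\<^sub>C Lam \<sigma> g) = (\<Sum>g\<in>F \<union> G. (if g \<in> F then a g else 0) *\<^sub>C Lam \<sigma> g)"
    using assms by (intro sum.mono_neutral_cong_left) (auto simp: scaleC_op_zero_left)
  moreover have "(\<Sum>g\<in>G. b g *\<^sub>C Lam \<sigma> g) = (\<Sum>g\<in>F \<union> G. (if g \<in> G then b g else 0) *\<^sub>C Lam \<sigma> g)"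
    using assms by (intro sum.mono_neutral_cong_left) (auto simp: scaleC_op_zero_left)
  ultimately show ?thesis by (simp add: scaleC_op_add_left sum.distrib)
qed

text \<open>The closure is taken in one summand at a time: y varies against a fixed finite
  combination, and then x varies.\<close>

lemma Cr_add:
  assumes "x \<in> Cr \<sigma>" "y \<in> Cr \<sigma>"
  shows "x + y \<in> Cr \<sigma>"
proof -
  have sum: "s + y \<in> Cr \<sigma>" if s: "s = (\<Sum>g\<in>F. a g *\<^sub>C Lam \<sigma> g)" "finite F" for s a F
    using assms(2)
  proof (induction rule: Cr_closure_induct)
    case (span b G)
    then show ?case using s by (simp add: span_add Cr_span)
  next
    case lim
    have "closed ((\<lambda>y. s + y) -` Cr \<sigma>)"
      by (intro continuous_closed_vimage closed_Cr continuous_intros)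
    then show ?case by (simp add: vimage_def)
  qed
  show ?thesis
    using assms(1)
  proof (induction rule: Cr_closure_induct)
    case (span a F)
    then show ?case using sum by blast
  next
    case lim
    have "closed ((\<lambda>x. x + y) -` Cr \<sigma>)"
      by (intro continuous_closed_vimage closed_Cr continuous_intros)
    then show ?case by (simp add: vimage_def)
  qed
qed

lemma Cr_diff: "x \<in> Cr \<sigma> \<Longrightarrow> y \<in> Cr \<sigma> \<Longrightarrow> x - y \<in> Cr \<sigma>"
  using Cr_add[OF _ Cr_scaleC, of x \<sigma> y "of_real (-1)"] unfolding scaleC_op_of_real by simp

text \<open>Elements of \<open>Cr \<sigma>\<close> are twisted convolution operators.\<close>

lemma Cr_apply_basis:
  assumes \<sigma>: "\<sigma> \<in> Z2" and "x \<in> Cr \<sigma>"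
  shows "ell2_fun (x (basis_ell2 c h)) k = c * \<sigma> (k - h) h * fourier_coeff x (k - h)"
  using assms(2)
proof (induction rule: Cr_closure_induct)
  case (span a F)
  have eq: "- g + k = h \<longleftrightarrow> g = k - h" for g
    by (metis add.assoc add_diff_cancel diff_add_cancel left_minus add_0 minus_add_cancel
        add_minus_cancel)
  have "ell2_fun (Lam \<sigma> g (basis_ell2 c h)) k = c * \<sigma> (k - h) h * fourier_coeff (Lam \<sigma> g) (k - h)"
      for g
    by (auto simp: ell2_fun_Lam[OF \<sigma>] ell2_fun_basis fourier_coeff_Lam[OF \<sigma>] eq)
  moreover have "fourier_coeff (\<Sum>g\<in>F. a g *\<^sub>C Lam \<sigma> g) (k - h) = (\<Sum>g\<in>F. a g * fourier_coeff (Lam \<sigma>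
      g) (k - h))"
    by (simp add: linear_sum[OF bounded_linear.linear[OF bounded_linear_fourier_coeff]]
        fourier_coeff_scaleC)
  ultimately show ?case
    by (simp add: blinfun.sum_left ell2_fun_sum scaleC_op_apply scaleC_ell2.rep_eq[of _
        "blinfun_apply _ _"]
        sum_distrib_left mult_ac)
next
  case lim
  show ?case
    by (intro closed_Collect_eq continuous_intros linear_continuous_on
        bounded_linear_blinfun_coeff bounded_linear_fourier_coeff)
qed

lemma Cr_eqI:
  assumes "\<sigma> \<in> Z2" "x \<in> Cr \<sigma>" "y \<in> Cr \<sigma>" "\<And>g. fourier_coeff x g = fourier_coeff y g"
  shows "x = y"
  by (rule op_eqI) (simp add: Cr_apply_basis[OF assms(1)] assms)

text \<open>The matrices of x and y carry the same cocycle factor, so the twist does not disturb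
  their relation as Schur multiples with kernel \<open>\<phi> (k - h)\<close>.\<close>

lemma Cr_multiplier_norm_le:
  assumes "\<sigma> \<in> Z2" "pos_def_fun \<phi>" "\<phi> 0 = 1" "x \<in> Cr \<sigma>" "y \<in> Cr \<sigma>"
    and "\<And>g. fourier_coeff y g = of_real (\<phi> g) * fourier_coeff x g"
  shows "norm y \<le> norm x"
  by (rule norm_le_of_pos_def_multiplier[OF assms(2,3)])
    (simp add: Cr_apply_basis[OF assms(1)] assms)

text \<open>On finite combinations the multiplier is explicit. The contraction estimate, applied to
  differences of approximants, makes the multiplied sequence Cauchy, and continuity of the
  coefficients identifies the limit.\<close>

lemma Cr_multiplier_exists:
  assumes \<sigma>: "\<sigma> \<in> Z2" and pd: "pos_def_fun \<phi>" "\<phi> 0 = 1" and x: "x \<in> Cr \<sigma>"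
  shows "\<exists>y\<in>Cr \<sigma>. \<forall>g. fourier_coeff y g = of_real (\<phi> g) * fourier_coeff x g"
proof -
  obtain a F where F: "\<And>n. finite (F n)" and lim: "(\<lambda>n. \<Sum>g\<in>F n. a n g *\<^sub>C Lam \<sigma> g) \<longlonglongrightarrow> x"
    using Cr_approx[OF x] by blast
  define s where "s n = (\<Sum>g\<in>F n. a n g *\<^sub>C Lam \<sigma> g)" for n
  define t where "t n = (\<Sum>g\<in>F n. (of_real (\<phi> g) * a n g) *\<^sub>C Lam \<sigma> g)" for n
  have Cr: "s n \<in> Cr \<sigma>" "t n \<in> Cr \<sigma>" for n by (auto simp: s_def t_def F Cr_span)
  have coeff: "fourier_coeff (t n) k = of_real (\<phi> k) * fourier_coeff (s n) k" for n k
    by (simp add: t_def s_def fourier_coeff_sum_Lam[OF \<sigma> F])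
  have "norm (t m - t n) \<le> norm (s m - s n)" for m n
    by (rule Cr_multiplier_norm_le[OF \<sigma> pd])
      (auto intro: Cr_diff Cr simp: coeff linear_diff[OF bounded_linear.linear[OF
          bounded_linear_fourier_coeff]] right_diff_distrib)
  moreover have "Cauchy s" using lim by (auto simp: s_def[abs_def] intro: LIMSEQ_imp_Cauchy)
  ultimately have "Cauchy t"
    unfolding Cauchy_def dist_norm by (meson order.strict_trans1)
  then obtain y where y: "t \<longlonglongrightarrow> y" by (auto simp: Cauchy_convergent_iff convergent_def)
  have "fourier_coeff y g = of_real (\<phi> g) * fourier_coeff x g" for g
  proof (rule LIMSEQ_unique)
    show "(\<lambda>n. fourier_coeff (t n) g) \<longlonglongrightarrow> fourier_coeff y g"
      by (rule bounded_linear.tendsto[OF bounded_linear_fourier_coeff y])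
    show "(\<lambda>n. fourier_coeff (t n) g) \<longlonglongrightarrow> of_real (\<phi> g) * fourier_coeff x g"
      unfolding coeff s_def by (intro tendsto_intros bounded_linear.tendsto[OF
          bounded_linear_fourier_coeff lim])
  qed
  moreover have "y \<in> Cr \<sigma>" using closed_sequentially[OF closed_Cr Cr(2) y] .
  ultimately show ?thesis by blast
qed

section \<open>The heat semigroup\<close>

lemma heat_op_props:
  fixes \<sigma> :: "'g::group_add \<Rightarrow> 'g \<Rightarrow> complex"
  assumes \<sigma>: "\<sigma> \<in> Z2" and d: "d \<in> ND0" and t: "t \<ge> 0" and x: "x \<in> Cr \<sigma>"
  shows heat_op_Cr: "heat_op \<sigma> d t x \<in> Cr \<sigma>"
    and fourier_coeff_heat_op: "fourier_coeff (heat_op \<sigma> d t x) g = of_real (exp (- t * d g)) *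
        fourier_coeff x g"
proof -
  define \<phi> where "\<phi> g = exp (- t * d g)" for g
  have pd: "pos_def_fun \<phi>" using pos_def_fun_exp_ND0[OF d t] by (simp add: \<phi>_def[abs_def])
  have "d 0 = 0" using d by (simp add: ND0_def)
  then have one: "\<phi> 0 = 1" by (simp add: \<phi>_def)
  \<comment> \<open>The choice is harmless, since coefficients determine y. The value
    \<open>undefined\<close> off \<open>Cr \<sigma>\<close> places M in the extensional function
    space.\<close>
  define M where "M x = (if x \<in> Cr \<sigma> then
    SOME y. y \<in> Cr \<sigma> \<and> (\<forall>g. fourier_coeff y g = of_real (\<phi> g) * fourier_coeff x g) else
        undefined)" for x :: "'g op"
  have M: "M x \<in> Cr \<sigma>" "fourier_coeff (M x) g = of_real (\<phi> g) * fourier_coeff x g" if "x \<in> Cr \<sigma>"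
      for x g
    using someI_ex[OF Cr_multiplier_exists[OF \<sigma> pd one that, unfolded Bex_def]] that by (auto
        simp: M_def)
  have fadd: "fourier_coeff (x + y) g = fourier_coeff x g + fourier_coeff y g" for x y and g :: 'g
    by (rule linear_add[OF bounded_linear.linear[OF bounded_linear_fourier_coeff]])
  let ?H = "\<lambda>M. M \<in> Cr \<sigma> \<rightarrow>\<^sub>E Cr \<sigma>
    \<and> (\<forall>x\<in>Cr \<sigma>. \<forall>y\<in>Cr \<sigma>. M (x + y) = M x + M y)
    \<and> (\<forall>c. \<forall>x\<in>Cr \<sigma>. M (c *\<^sub>C x) = c *\<^sub>C M x)
    \<and> (\<exists>K. \<forall>x\<in>Cr \<sigma>. norm (M x) \<le> K * norm x)
    \<and> (\<forall>g. M (Lam \<sigma> g) = of_real (exp (- t * d g)) *\<^sub>C Lam \<sigma> g)"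
  have HM: "?H M"
  proof (intro conjI allI ballI)
    show "M \<in> Cr \<sigma> \<rightarrow>\<^sub>E Cr \<sigma>" using M by (auto simp: M_def)
    show "M (x + y) = M x + M y" if "x \<in> Cr \<sigma>" "y \<in> Cr \<sigma>" for x y
      by (rule Cr_eqI[OF \<sigma>]) (auto simp: that M Cr_add fadd distrib_left)
    show "M (c *\<^sub>C x) = c *\<^sub>C M x" if "x \<in> Cr \<sigma>" for x c
      by (rule Cr_eqI[OF \<sigma>]) (auto simp: that M Cr_scaleC fourier_coeff_scaleC)
    have "\<forall>x\<in>Cr \<sigma>. norm (M x) \<le> 1 * norm x"
      using Cr_multiplier_norm_le[OF \<sigma> pd one] M by simp
    then show "\<exists>K. \<forall>x\<in>Cr \<sigma>. norm (M x) \<le> K * norm x" by blast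
    show "M (Lam \<sigma> g) = of_real (exp (- t * d g)) *\<^sub>C Lam \<sigma> g" for g
      by (rule Cr_eqI[OF \<sigma>])
        (auto simp: M Cr_Lam Cr_scaleC fourier_coeff_scaleC fourier_coeff_Lam[OF \<sigma>] \<phi>_def)
  qed
  have uniq: "N = M" if N: "?H N" for N
  proof
    fix x
    show "N x = M x"
    proof (cases "x \<in> Cr \<sigma>")
      case False
      then show ?thesis using N HM by (auto simp: PiE_def extensional_def)
    next
      case True
      \<comment> \<open>The difference of two candidates is additive and bounded on
        \<open>Cr \<sigma>\<close> and kills every multiple of \<open>Lam \<sigma> g\<close>, so it
        vanishes on the finite combinations and, by density, at x.\<close>
      define D where "D x = N x - M x" for x
      have add: "D (x + y) = D x + D y" if "x \<in> Cr \<sigma>" "y \<in> Cr \<sigma>" for x y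
        using N HM that by (auto simp: D_def)
      have "N (c *\<^sub>C Lam \<sigma> g) = c *\<^sub>C N (Lam \<sigma> g)" "M (c *\<^sub>C Lam \<sigma> g) = c *\<^sub>C M (Lam \<sigma> g)" for c g
        using N HM Cr_Lam by blast+
      then have D_Lam: "D (c *\<^sub>C Lam \<sigma> g) = 0" for c g using N HM by (simp add: D_def)
      have span: "finite F \<Longrightarrow> D (\<Sum>g\<in>F. a g *\<^sub>C Lam \<sigma> g) = 0" for F a
      proof (induction F rule: finite_induct)
        case empty
        \<comment> \<open>Additivity at 0 + 0 gives D 0 = 0.\<close>
        show ?case using add[of 0 0] Cr_span[of "{}" _ \<sigma>] by simp
      next
        case (insert g F)
        then show ?case using add[OF Cr_scaleC[OF Cr_Lam] Cr_span[of F]] D_Lam by simp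
      qed
      obtain K L where "\<forall>x\<in>Cr \<sigma>. norm (N x) \<le> K * norm x" "\<forall>x\<in>Cr \<sigma>. norm (M x) \<le> L * norm x"
        using N HM by blast
      then have bound: "norm (D x) \<le> (K + L) * norm x" if "x \<in> Cr \<sigma>" for x
        using that norm_triangle_ineq4[of "N x" "M x"] by (fastforce simp: D_def distrib_right)
      obtain a F where F: "\<And>n. finite (F n)" and lim: "(\<lambda>n. \<Sum>g\<in>F n. a n g *\<^sub>C Lam \<sigma> g) \<longlonglongrightarrow> x"
        using Cr_approx[OF True] by blast
      define s where "s n = (\<Sum>g\<in>F n. a n g *\<^sub>C Lam \<sigma> g)" for n
      have s: "s n \<in> Cr \<sigma>" "D (s n) = 0" for n unfolding s_def by (rule Cr_span[OF F], rule
          span[OF F])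
      have diff: "x - s n \<in> Cr \<sigma>" for n using Cr_diff[OF True s(1)] .
      have le: "norm (D x) \<le> (K + L) * norm (x - s n)" for n
        using add[OF diff s(1), of n n] s(2) bound[OF diff, of n] by simp
      have "(\<lambda>n. (K + L) * norm (x - s n)) \<longlonglongrightarrow> (K + L) * norm (x - x)"
        using lim unfolding s_def[symmetric] by (intro tendsto_intros)
      then have "norm (D x) \<le> (K + L) * norm (x - x)"
        by (rule LIMSEQ_le_const) (use le in blast)
      then show ?thesis by (simp add: D_def)
    qed
  qed
  have "heat_op \<sigma> d t = M"
    unfolding heat_op_def by (rule the_equality) (use HM uniq in blast)+
  then show "heat_op \<sigma> d t x \<in> Cr \<sigma>"
    "fourier_coeff (heat_op \<sigma> d t x) g = of_real (exp (- t * d g)) * fourier_coeff x g"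
    using M[OF x] by (auto simp: \<phi>_def)
qed

section \<open>Unordered convergence and bounded multipliers\<close>

text \<open>Cauchy criterion for unordered sums: a sum off F0 is the difference of two partial sums
  over sets containing F0.\<close>

lemma summable_on_small_tails:
  fixes f :: "'a \<Rightarrow> 'b :: real_normed_vector"
  assumes "f summable_on UNIV" "e > 0"
  obtains F0 where "finite F0" "\<And>F. finite F \<Longrightarrow> F \<inter> F0 = {} \<Longrightarrow> norm (sum f F) \<le> e"
proof -
  from assms(1) obtain s where "(sum f \<longlongrightarrow> s) (finite_subsets_at_top UNIV)"
    unfolding summable_on_def has_sum_def by blast
  then have "\<forall>\<^sub>F F in finite_subsets_at_top UNIV. dist (sum f F) s < e / 2"
    using assms(2) by (intro tendstoD) auto
  then obtain F0 where F0: "finite F0" "\<And>F. finite F \<Longrightarrow> F0 \<subseteq> F \<Longrightarrow> dist (sum f F) s < e / 2"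
    unfolding eventually_finite_subsets_at_top by auto
  have "norm (sum f F) \<le> e" if "finite F" "F \<inter> F0 = {}" for F
  proof -
    have "sum f F = sum f (F \<union> F0) - sum f F0"
      using that F0(1) by (simp add: sum.union_disjoint)
    then have "norm (sum f F) = dist (sum f (F \<union> F0)) (sum f F0)" by (simp add: dist_norm)
    also have "\<dots> \<le> dist (sum f (F \<union> F0)) s + dist (sum f F0) s" by (rule dist_triangle2)
    finally show ?thesis using F0(2)[of "F \<union> F0"] F0(2)[of F0] F0(1) that by simp
  qed
  then show thesis using that F0(1) by blast
qed

text \<open>The converse criterion, which needs completeness: small tails make the net of partial
  sums a Cauchy filter.\<close>

lemma summable_on_of_small_tails:
  fixes f :: "'a \<Rightarrow> 'b :: banach"
  assumes "\<And>e. e > 0 \<Longrightarrow> \<exists>F0. finite F0 \<and> (\<forall>F. finite F \<and> F \<inter> F0 = {} \<longrightarrow> norm (sum f F) \<le> e)"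
  shows "f summable_on UNIV"
proof -
  have "\<exists>P. eventually P (finite_subsets_at_top UNIV) \<and>
      (\<forall>F F'. P F \<and> P F' \<longrightarrow> dist (sum f F) (sum f F') < e)" if "e > 0" for e
  proof -
    obtain F0 where F0: "finite F0" "\<And>F. finite F \<Longrightarrow> F \<inter> F0 = {} \<Longrightarrow> norm (sum f F) \<le> e / 4"
      using assms[of "e / 4"] \<open>e > 0\<close> by auto
    have near: "dist (sum f F) (sum f F0) \<le> e / 4" if "finite F" "F0 \<subseteq> F" for F
      using F0(2)[of "F - F0"] that by (simp add: dist_norm sum_diff Diff_Int_distrib2)
    have "dist (sum f F) (sum f F') < e" if "finite F \<and> F0 \<subseteq> F" "finite F' \<and> F0 \<subseteq> F'" for F F'
      using dist_triangle2[of "sum f F" "sum f F'" "sum f F0"] near[of F] near[of F'] that \<open>e > 0\<close>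
          by simp
    moreover have "\<forall>\<^sub>F F in finite_subsets_at_top UNIV. finite F \<and> F0 \<subseteq> F"
      unfolding eventually_finite_subsets_at_top using F0(1) by auto
    ultimately show ?thesis by blast
  qed
  then have "cauchy_filter (filtermap (sum f) (finite_subsets_at_top UNIV))"
    by (simp add: cauchy_filter_metric_filtermap)
  moreover have "complete (UNIV :: 'b set)"
    by (meson Cauchy_convergent UNIV_I complete_def convergent_def)
  ultimately obtain L where "(sum f \<longlongrightarrow> L) (finite_subsets_at_top UNIV)"
    using complete_uniform[where S = UNIV] by (force simp add: filterlim_def)
  then show ?thesis
    using summable_on_def has_sum_def by blast
qed

text \<open>The left-hand side is convex in each \<open>c\<^sub>i\<close>, so it is largest when all \<open>c\<^sub>i\<close> are \<open>0\<close> or \<open>1\<close>.\<close>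

lemma norm_sum_scaleR_le_subset_sums:
  fixes f :: "'a \<Rightarrow> 'b :: real_normed_vector"
  assumes "finite F" "\<And>S. S \<subseteq> F \<Longrightarrow> norm (y + sum f S) \<le> e"
    and "\<And>i. i \<in> F \<Longrightarrow> 0 \<le> c i \<and> c i \<le> 1"
  shows "norm (y + (\<Sum>i\<in>F. c i *\<^sub>R f i)) \<le> e"
  using assms
proof (induction F arbitrary: y rule: finite_induct)
  case empty
  then show ?case by simp
next
  case (insert a F)
  have 1: "norm (y + (\<Sum>i\<in>F. c i *\<^sub>R f i)) \<le> e"
    by (rule insert.IH) (use insert.prems in auto)
  have 2: "norm ((y + f a) + (\<Sum>i\<in>F. c i *\<^sub>R f i)) \<le> e"
  proof (rule insert.IH)
    fix S assume S: "S \<subseteq> F"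
    then have "a \<notin> S" "finite S" using insert.hyps finite_subset by auto
    then show "norm ((y + f a) + sum f S) \<le> e"
      using insert.prems(1)[of "insert a S"] S by (simp add: add.assoc subset_insertI2)
  qed (use insert.prems in auto)
  have "y + (\<Sum>i\<in>insert a F. c i *\<^sub>R f i)
    = (1 - c a) *\<^sub>R (y + (\<Sum>i\<in>F. c i *\<^sub>R f i)) + c a *\<^sub>R ((y + f a) + (\<Sum>i\<in>F. c i *\<^sub>R f i))"
    using insert.hyps by (simp add: algebra_simps)
  also have "norm \<dots> \<le> (1 - c a) * e + c a * e"
    using 1 2 insert.prems(2)[of a]
    by (intro order_trans[OF norm_triangle_ineq] add_mono) (simp_all add: mult_left_mono)
  finally show ?case by (simp add: algebra_simps)
qed

text \<open>The positive and negative parts of \<open>c i / B\<close> take values between 0 and 1;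
  treating them separately costs the factor 2.\<close>

lemma norm_sum_scaleR_le:
  fixes f :: "'a \<Rightarrow> 'b :: real_normed_vector"
  assumes F: "finite F" and f: "\<And>S. S \<subseteq> F \<Longrightarrow> norm (sum f S) \<le> e"
    and c: "\<And>i. \<bar>c i\<bar> \<le> B"
  shows "norm (\<Sum>i\<in>F. c i *\<^sub>R f i) \<le> 2 * e * B"
proof (cases "B = 0")
  case True
  then show ?thesis using c by simp
next
  case False
  then have B: "B > 0" using c[of undefined] by linarith
  have "norm (0 + (\<Sum>i\<in>F. (max (c i) 0 / B) *\<^sub>R f i)) \<le> e"
    using B by (intro norm_sum_scaleR_le_subset_sums F) (auto simp: f order_trans[OF abs_ge_self c])
  moreover have "norm (0 + (\<Sum>i\<in>F. (max (- c i) 0 / B) *\<^sub>R f i)) \<le> e"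
    using B by (intro norm_sum_scaleR_le_subset_sums F) (auto simp: f order_trans[OF
        abs_ge_minus_self c])
  moreover have "(\<Sum>i\<in>F. c i *\<^sub>R f i)
    = B *\<^sub>R ((\<Sum>i\<in>F. (max (c i) 0 / B) *\<^sub>R f i) - (\<Sum>i\<in>F. (max (- c i) 0 / B) *\<^sub>R f i))"
    unfolding sum_subtractf[symmetric] scaleR_sum_right
    using B by (intro sum.cong refl) (auto simp: max_def scaleR_left_diff_distrib[symmetric])
  ultimately show ?thesis
    using B norm_triangle_ineq4[of "\<Sum>i\<in>F. (max (c i) 0 / B) *\<^sub>R f i" "\<Sum>i\<in>F. (max (- c i) 0 / B)
        *\<^sub>R f i"]
    by (simp add: mult.commute)
qed

lemma summable_on_bounded_multiplier:
  fixes f :: "'a \<Rightarrow> 'b :: banach"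
  assumes f: "f summable_on UNIV" and c: "\<And>i. \<bar>c i\<bar> \<le> B"
  shows "(\<lambda>i. c i *\<^sub>R f i) summable_on UNIV"
proof (rule summable_on_of_small_tails)
  fix e :: real assume e: "e > 0"
  have B: "B \<ge> 0" using c[of undefined] by linarith
  \<comment> \<open>The summand 1 in the denominator covers B = 0.\<close>
  obtain F0 where F0: "finite F0" "\<And>F. finite F \<Longrightarrow> F \<inter> F0 = {} \<Longrightarrow> norm (sum f F) \<le> e / (2 * B + 1)"
    using summable_on_small_tails[OF f, of "e / (2 * B + 1)"] e B by auto
  have "norm (\<Sum>i\<in>F. c i *\<^sub>R f i) \<le> e" if F: "finite F" "F \<inter> F0 = {}" for F
  proof -
    have "norm (\<Sum>i\<in>F. c i *\<^sub>R f i) \<le> 2 * (e / (2 * B + 1)) * B"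
      by (rule norm_sum_scaleR_le[OF F(1) F0(2) c]) (use F finite_subset in auto)
    also have "\<dots> \<le> e" using e B by (simp add: field_simps)
    finally show ?thesis .
  qed
  then show "\<exists>F0. finite F0 \<and> (\<forall>F. finite F \<and> F \<inter> F0 = {} \<longrightarrow> norm (\<Sum>i\<in>F. c i *\<^sub>R f i) \<le> e)"
    using F0(1) by blast
qed

text \<open>The point is that A depends on the series alone: multipliers of size O(h^2) then give
  sums of size O(h^2).\<close>

lemma norm_infsum_bounded_multiplier:
  fixes f :: "'a \<Rightarrow> 'b :: banach"
  assumes f: "f summable_on UNIV"
  obtains A where "\<And>c B. (\<And>i. \<bar>c i\<bar> \<le> B) \<Longrightarrow> norm (\<Sum>\<^sub>\<infinity>i. c i *\<^sub>R f i) \<le> A * B"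
proof -
  obtain F0 where F0: "finite F0" "\<And>F. finite F \<Longrightarrow> F \<inter> F0 = {} \<Longrightarrow> norm (sum f F) \<le> 1"
    using summable_on_small_tails[OF f, of 1] by auto
  \<comment> \<open>A finite sum splits into a part inside F0, bounded by the norms of its terms,
    and a part off F0, bounded by 1.\<close>
  define e where "e = (\<Sum>i\<in>F0. norm (f i)) + 1"
  have e: "norm (sum f S) \<le> e" if "finite S" for S
  proof -
    have "sum f S = sum f (S \<inter> F0) + sum f (S - F0)"
      using sum.Int_Diff[OF that] .
    moreover have "norm (sum f (S \<inter> F0)) \<le> (\<Sum>i\<in>F0. norm (f i))"
      by (rule order_trans[OF norm_sum sum_mono2]) (use F0 in auto)
    moreover have "norm (sum f (S - F0)) \<le> 1" using F0(2)[of "S - F0"] that by blast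
    ultimately show ?thesis
      unfolding e_def using norm_triangle_ineq[of "sum f (S \<inter> F0)" "sum f (S - F0)"] by simp
  qed
  have "norm (\<Sum>\<^sub>\<infinity>i. c i *\<^sub>R f i) \<le> 2 * e * B" if c: "\<And>i. \<bar>c i\<bar> \<le> B" for c B
  proof (rule tendsto_upperbound)
    have "((\<lambda>i. c i *\<^sub>R f i) has_sum (\<Sum>\<^sub>\<infinity>i. c i *\<^sub>R f i)) UNIV"
      using summable_on_bounded_multiplier[OF f c] by simp
    then show "((\<lambda>F. norm (\<Sum>i\<in>F. c i *\<^sub>R f i)) \<longlongrightarrow> norm (\<Sum>\<^sub>\<infinity>i. c i *\<^sub>R f i)) (finite_subsets_at_top
        UNIV)"
      unfolding has_sum_def by (rule tendsto_norm)
    show "\<forall>\<^sub>F F in finite_subsets_at_top UNIV. norm (\<Sum>i\<in>F. c i *\<^sub>R f i) \<le> 2 * e * B"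
    proof (rule eventually_finite_subsets_at_top_weakI)
      fix F :: "'a set" assume "finite F"
      then show "norm (\<Sum>i\<in>F. c i *\<^sub>R f i) \<le> 2 * e * B"
        by (intro norm_sum_scaleR_le c e) (auto intro: finite_subset)
    qed
  qed simp
  then show thesis using that by blast
qed

section \<open>Scalar estimates for the damping factors\<close>

lemma mult_exp_le:
  fixes r D :: real
  assumes "r > 0" "D \<ge> 0"
  shows "D * exp (- r * D) \<le> 1 / r"
proof -
  have "r * D \<le> exp (r * D)" using exp_ge_add_one_self[of "r * D"] by linarith
  then have "r * D * exp (- (r * D)) \<le> 1" by (simp add: exp_minus field_simps)
  then show ?thesis using assms(1) by (simp add: field_simps)
qed

lemma square_mult_exp_le:
  fixes r D :: real
  assumes "r > 0" "D \<ge> 0"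
  shows "D\<^sup>2 * exp (- r * D) \<le> 2 / r\<^sup>2"
proof -
  have "(r * D)\<^sup>2 / 2 \<le> exp (r * D)"
    using exp_lower_Taylor_quadratic[of "r * D"] mult_nonneg_nonneg[of r D] assms by linarith
  then have "(r * D)\<^sup>2 * exp (- (r * D)) \<le> 2" by (simp add: exp_minus field_simps)
  then show ?thesis using assms(1) by (simp add: field_simps power_mult_distrib)
qed

text \<open>For z = - h D the left side is exp (- c D) times the first-order Taylor remainder of exp
  at z, which is at most exp |z| z^2. The condition on h lets half of the damping absorb exp |z|;
  the other half absorbs D^2, and 8 / c^2 is 2 / r^2 at r = c / 2. The bound is uniform in
  D.\<close>

lemma exp_Taylor_remainder:
  fixes c h D :: real
  assumes c: "c > 0" and h: "\<bar>h\<bar> \<le> c / 2" and D: "D \<ge> 0"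
  shows "\<bar>exp (- (c + h) * D) - exp (- c * D) + h * (D * exp (- c * D))\<bar> \<le> h\<^sup>2 * (8 / c\<^sup>2)"
proof -
  define z where "z = - (h * D)"
  have "cmod (exp (of_real z) - (\<Sum>k\<le>1. of_real z ^ k / fact k)) \<le> exp \<bar>Re (of_real z)\<bar> * cmod
      (of_real z) ^ Suc 1 / fact 1"
    by (rule Taylor_exp)
  moreover have "exp (complex_of_real z) - (\<Sum>k\<le>1. of_real z ^ k / fact k) = of_real (exp z - (1 +
      z))"
    by (simp add: exp_of_real)
  ultimately have z: "\<bar>exp z - (1 + z)\<bar> \<le> exp \<bar>z\<bar> * z\<^sup>2"
    by (simp only: norm_of_real Re_complex_of_real) (simp add: power2_eq_square abs_mult_self_eq)
  have "exp (- (c + h) * D) - exp (- c * D) + h * (D * exp (- c * D)) = exp (- c * D) * (exp z -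
      (1 + z))"
    by (simp add: z_def algebra_simps flip: exp_add)
  then have "\<bar>exp (- (c + h) * D) - exp (- c * D) + h * (D * exp (- c * D))\<bar> = exp (- c * D) *
      \<bar>exp z - (1 + z)\<bar>"
    by (simp add: abs_mult)
  also have "\<dots> \<le> exp (- c * D) * (exp \<bar>z\<bar> * z\<^sup>2)" using z by simp
  also have "\<dots> = exp (\<bar>z\<bar> - c * D) * z\<^sup>2" by (simp add: exp_diff exp_minus field_simps)
  also have "\<dots> \<le> exp (- (c / 2) * D) * z\<^sup>2"
  proof -
    have "\<bar>z\<bar> \<le> c / 2 * D" using mult_right_mono[OF h D] D by (simp add: z_def abs_mult)
    then have "\<bar>z\<bar> - c * D \<le> - (c / 2) * D" by (simp add: algebra_simps)
    then show ?thesis by (intro mult_right_mono) auto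
  qed
  also have "\<dots> = h\<^sup>2 * (D\<^sup>2 * exp (- (c / 2) * D))" by (simp add: z_def power_mult_distrib)
  also have "\<dots> \<le> h\<^sup>2 * (2 / (c / 2)\<^sup>2)"
    by (intro mult_left_mono square_mult_exp_le) (use c D in auto)
  also have "\<dots> = h\<^sup>2 * (8 / c\<^sup>2)" by (simp add: power_divide)
  finally show ?thesis .
qed

text \<open>The error of the linear approximation is itself a multiplied series of f, with the
  scalar Taylor remainders as multipliers, so their uniform bound carries over to the norm.\<close>

lemma has_vector_derivative_infsum_exp:
  fixes f :: "'a \<Rightarrow> 'b :: banach" and d :: "'a \<Rightarrow> real"
  assumes f: "f summable_on UNIV" and d: "\<And>g. d g \<ge> 0" and c: "c > 0"
  shows "((\<lambda>t. \<Sum>\<^sub>\<infinity>g. exp (- t * d g) *\<^sub>R f g) has_vector_derivative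
    - (\<Sum>\<^sub>\<infinity>g. (d g * exp (- c * d g)) *\<^sub>R f g)) (at c)"
proof -
  obtain A where A: "\<And>c B. (\<And>i. \<bar>c i\<bar> \<le> B) \<Longrightarrow> norm (\<Sum>\<^sub>\<infinity>i. c i *\<^sub>R f i) \<le> A * B"
    using norm_infsum_bounded_multiplier[OF f] by blast
  define U where "U t = (\<Sum>\<^sub>\<infinity>g. exp (- t * d g) *\<^sub>R f g)" for t
  define V where "V = (\<Sum>\<^sub>\<infinity>g. (d g * exp (- c * d g)) *\<^sub>R f g)"
  have sU: "(\<lambda>g. exp (- t * d g) *\<^sub>R f g) summable_on UNIV" if "t \<ge> 0" for t
    by (rule summable_on_bounded_multiplier[OF f, of _ 1]) (use that d in auto)
  have sV: "(\<lambda>g. (d g * exp (- c * d g)) *\<^sub>R f g) summable_on UNIV"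
    by (rule summable_on_bounded_multiplier[OF f, of _ "1 / c"]) (use mult_exp_le[OF c d] d in auto)
  \<comment> \<open>The condition on h also keeps c + h positive, so that the series at c + h
    converges.\<close>
  have bound: "norm (U (c + h) - U c - h *\<^sub>R - V) / norm h \<le> A * (8 / c\<^sup>2) * \<bar>h\<bar>"
    if h: "\<bar>h\<bar> < c / 2" for h
  proof -
    have "U (c + h) - U c - h *\<^sub>R - V
      = (\<Sum>\<^sub>\<infinity>g. exp (- (c + h) * d g) *\<^sub>R f g) + (\<Sum>\<^sub>\<infinity>g. (- 1) *\<^sub>R exp (- c * d g) *\<^sub>R f g)
        + (\<Sum>\<^sub>\<infinity>g. h *\<^sub>R (d g * exp (- c * d g)) *\<^sub>R f g)"
      unfolding U_def V_def infsum_scaleR_right by simp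
    also have "\<dots> = (\<Sum>\<^sub>\<infinity>g. exp (- (c + h) * d g) *\<^sub>R f g + (- 1) *\<^sub>R exp (- c * d g) *\<^sub>R f g
        + h *\<^sub>R (d g * exp (- c * d g)) *\<^sub>R f g)"
      using h c by (simp only: infsum_add summable_on_add summable_on_scaleR_right sU sV
          less_imp_le)
    also have "\<dots> = (\<Sum>\<^sub>\<infinity>g. (exp (- (c + h) * d g) - exp (- c * d g) + h * (d g * exp (- c * d g)))
        *\<^sub>R f g)"
      by (intro infsum_cong) (simp add: scaleR_left_diff_distrib scaleR_left_distrib)
    also have "norm \<dots> \<le> A * (h\<^sup>2 * (8 / c\<^sup>2))"
      by (rule A exp_Taylor_remainder)+ (use c h d in auto)
    finally show ?thesis using c by (cases "h = 0") (auto simp: divide_simps power2_eq_square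
        abs_mult_self_eq mult_ac)
  qed
  have "((\<lambda>h. norm (U (c + h) - U c - h *\<^sub>R - V) / norm h) \<longlongrightarrow> 0) (at 0)"
  proof (rule tendsto_sandwich[OF _ _ tendsto_const])
    show "\<forall>\<^sub>F h in at 0. norm (U (c + h) - U c - h *\<^sub>R - V) / norm h \<le> A * (8 / c\<^sup>2) * \<bar>h\<bar>"
      unfolding eventually_at using c bound by (intro exI[of _ "c / 2"]) auto
    show "((\<lambda>h. A * (8 / c\<^sup>2) * \<bar>h\<bar>) \<longlongrightarrow> 0) (at 0)"
      using c by (auto intro!: tendsto_eq_intros)
  qed auto
  then show ?thesis
    unfolding has_vector_derivative_def has_derivative_at U_def[symmetric] V_def[symmetric]
    by (auto intro: bounded_linear_scaleR_left bounded_linear_minus)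
qed

section \<open>The heat problem\<close>

lemma scaleC_op_of_real_mult: "(of_real r * a) *\<^sub>C x = r *\<^sub>R (a *\<^sub>C x)"
  by (simp flip: scaleC_op_assoc scaleC_op_of_real)

lemma has_sum_Lam:
  assumes \<sigma>: "\<sigma> \<in> Z2" and s: "((\<lambda>g. b g *\<^sub>C Lam \<sigma> g) has_sum s) UNIV"
  shows has_sum_Lam_Cr: "s \<in> Cr \<sigma>" and has_sum_Lam_coeff: "fourier_coeff s k = b k"
proof -
  show "s \<in> Cr \<sigma>"
    by (rule Lim_in_closed_set[OF closed_Cr _ _ s[unfolded has_sum_def]])
      (auto intro: eventually_finite_subsets_at_top_weakI Cr_span)
  have "((\<lambda>g. fourier_coeff (b g *\<^sub>C Lam \<sigma> g) k) has_sum fourier_coeff s k) UNIV"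
    by (rule has_sum_bounded_linear[OF bounded_linear_fourier_coeff s])
  moreover have "((\<lambda>g. fourier_coeff (b g *\<^sub>C Lam \<sigma> g) k) has_sum b k) UNIV
    \<longleftrightarrow> ((\<lambda>g. b g) has_sum b k) {k}"
    by (rule has_sum_cong_neutral) (auto simp: fourier_coeff_scaleC fourier_coeff_Lam[OF \<sigma>])
  ultimately show "fourier_coeff s k = b k"
    by (auto intro: has_sum_unique has_sum_finiteI)
qed

text \<open>Membership in \<open>CF \<sigma>\<close> asserts convergence without naming the limit;
  the limit is x because it lies in \<open>Cr \<sigma>\<close> and has the same
  coefficients.\<close>

lemma CF_has_sum:
  assumes \<sigma>: "\<sigma> \<in> Z2" and x: "x \<in> CF \<sigma>"
  shows "((\<lambda>g. fourier_coeff x g *\<^sub>C Lam \<sigma> g) has_sum x) UNIV"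
proof -
  obtain s where s: "((\<lambda>g. fourier_coeff x g *\<^sub>C Lam \<sigma> g) has_sum s) UNIV"
    using x unfolding CF_def summable_on_def by blast
  have "s = x"
    by (rule Cr_eqI[OF \<sigma>]) (use x in \<open>auto simp: CF_def has_sum_Lam[OF \<sigma> s]\<close>)
  then show ?thesis using s by simp
qed

text \<open>The Fourier series of x may diverge, so continuity at 0 comes from a finite combination
  s near x: its evolution is a finite sum continuous in t, and contractivity bounds the rest
  uniformly in t.\<close>

lemma heat_op_tendsto_at_right_0:
  assumes \<sigma>: "\<sigma> \<in> Z2" and d: "d \<in> ND0" and x: "x \<in> Cr \<sigma>"
  shows "((\<lambda>t. heat_op \<sigma> d t x) \<longlongrightarrow> x) (at_right 0)"
proof (rule tendstoI)
  fix e :: real assume "e > 0"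
  obtain a F where F: "\<And>n. finite (F n)" and lim: "(\<lambda>n. \<Sum>g\<in>F n. a n g *\<^sub>C Lam \<sigma> g) \<longlonglongrightarrow> x"
    using Cr_approx[OF x] by blast
  have "\<forall>\<^sub>F n in sequentially. dist (\<Sum>g\<in>F n. a n g *\<^sub>C Lam \<sigma> g) x < e / 3"
    using lim \<open>e > 0\<close> by (intro tendstoD) auto
  then obtain n where n: "dist (\<Sum>g\<in>F n. a n g *\<^sub>C Lam \<sigma> g) x < e / 3"
    unfolding eventually_sequentially by blast
  define s where "s = (\<Sum>g\<in>F n. a n g *\<^sub>C Lam \<sigma> g)"
  have s: "s \<in> Cr \<sigma>" unfolding s_def by (rule Cr_span[OF F])
  define S where "S t = (\<Sum>g\<in>F n. exp (- t * d g) *\<^sub>R (a n g *\<^sub>C Lam \<sigma> g))" for t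
  have S_eq: "heat_op \<sigma> d t s = S t" if t: "t \<ge> 0" for t
  proof (rule Cr_eqI[OF \<sigma> heat_op_Cr[OF \<sigma> d t s]])
    show "S t \<in> Cr \<sigma>"
      unfolding S_def scaleC_op_of_real_mult[symmetric] by (rule Cr_span[OF F])
    show "fourier_coeff (heat_op \<sigma> d t s) k = fourier_coeff (S t) k" for k
      using F unfolding fourier_coeff_heat_op[OF \<sigma> d t s] unfolding S_def s_def
          scaleC_op_of_real_mult[symmetric]
      by (simp add: fourier_coeff_sum_Lam[OF \<sigma>])
  qed
  have "(S \<longlongrightarrow> S 0) (at_right 0)"
    unfolding S_def by (intro tendsto_intros)
  moreover have "S 0 = s" by (simp add: S_def s_def)
  ultimately have "\<forall>\<^sub>F t in at_right 0. dist (S t) s < e / 3"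
    using \<open>e > 0\<close> by (intro tendstoD) auto
  moreover have "\<forall>\<^sub>F t :: real in at_right 0. t > 0"
    by (rule eventually_at_right_less)
  ultimately show "\<forall>\<^sub>F t in at_right 0. dist (heat_op \<sigma> d t x) x < e"
  proof eventually_elim
    case (elim t)
    then have t: "t \<ge> 0" by simp
    have "d 0 = 0" using d by (simp add: ND0_def)
    then have "norm (heat_op \<sigma> d t x - heat_op \<sigma> d t s) \<le> norm (x - s)"
      by (intro Cr_multiplier_norm_le[OF \<sigma> pos_def_fun_exp_ND0[OF d t]] Cr_diff heat_op_Cr \<sigma> d t x
          s)
        (simp_all add: linear_diff[OF bounded_linear.linear[OF bounded_linear_fourier_coeff]]
          fourier_coeff_heat_op[OF \<sigma> d t] x s right_diff_distrib)
    then have "dist (heat_op \<sigma> d t x) (S t) \<le> dist s x"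
      by (simp add: S_eq[OF t] dist_norm norm_minus_commute)
    moreover have "dist (heat_op \<sigma> d t x) x \<le> dist (heat_op \<sigma> d t x) (S t) + dist (S t) s + dist s
        x"
      using dist_triangle[of "heat_op \<sigma> d t x" x "S t"] dist_triangle[of "S t" x s] by linarith
    ultimately show ?case using elim n unfolding s_def[symmetric] by linarith
  qed
qed

lemma heat_op_0:
  assumes "\<sigma> \<in> Z2" "d \<in> ND0" "x \<in> Cr \<sigma>"
  shows "heat_op \<sigma> d 0 x = x"
  by (rule Cr_eqI[OF assms(1)]) (simp_all add: assms heat_op_Cr fourier_coeff_heat_op)

lemma fourier_coeff_heat_gen:
  assumes \<sigma>: "\<sigma> \<in> Z2" and x: "x \<in> heat_dom \<sigma> d"
  shows "fourier_coeff (heat_gen \<sigma> d x) g = - (d g *\<^sub>R fourier_coeff x g)"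
proof -
  have "((\<lambda>g. (of_real (d g) * fourier_coeff x g) *\<^sub>C Lam \<sigma> g) has_sum - heat_gen \<sigma> d x) UNIV"
    using x by (simp add: heat_dom_def heat_gen_def)
  from has_sum_Lam_coeff[OF \<sigma> this, of g]
  have "- fourier_coeff (heat_gen \<sigma> d x) g = d g *\<^sub>R fourier_coeff x g"
    by (simp add: linear_neg[OF bounded_linear.linear[OF bounded_linear_fourier_coeff]]
        scaleR_conv_of_real)
  then show ?thesis by (metis minus_minus)
qed

text \<open>Half of the time \<open>t\<close> makes the Fourier series converge; the factors \<open>exp (- (t - s) d)\<close> that
  remain for \<open>s = t / 2\<close> bound every polynomial in \<open>d\<close>.\<close>

lemma heat_op_generator:
  assumes \<sigma>: "\<sigma> \<in> Z2" and d: "d \<in> ND0" and hp: "heat_property \<sigma> d" and x: "x \<in> Cr \<sigma>" and t: "t > 0"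
  shows heat_op_heat_dom: "heat_op \<sigma> d t x \<in> heat_dom \<sigma> d"
    and has_vector_derivative_heat_op:
      "((\<lambda>t. heat_op \<sigma> d t x) has_vector_derivative heat_gen \<sigma> d (heat_op \<sigma> d t x)) (at t)"
proof -
  have d0: "d g \<ge> 0" for g using d by (simp add: ND0_def)
  define y where "y g = fourier_coeff x g *\<^sub>C Lam \<sigma> g" for g
  define s where "s = t / 2"
  define f where "f g = exp (- s * d g) *\<^sub>R y g" for g
  have heat_sum: "((\<lambda>g. exp (- r * d g) *\<^sub>R y g) has_sum heat_op \<sigma> d r x) UNIV" if r: "r > 0" for r
    using CF_has_sum[OF \<sigma>, of "heat_op \<sigma> d r x"] hp r x
    unfolding heat_property_def y_def scaleC_op_of_real_mult[symmetric]
    by (simp add: fourier_coeff_heat_op[OF \<sigma> d less_imp_le[OF r] x])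
  have f: "f summable_on UNIV"
    using heat_sum[of s] t unfolding f_def[abs_def] s_def summable_on_def by auto
  \<comment> \<open>For r < s the multiplier is unbounded if d is, and convergence then comes from
    the heat property at time r itself. The derivative is taken at t - s > 0.\<close>
  have U: "heat_op \<sigma> d r x = (\<Sum>\<^sub>\<infinity>g. exp (- (r - s) * d g) *\<^sub>R f g)" if "r > 0" for r
    using heat_sum[OF that] by (simp add: f_def infsumI algebra_simps flip: exp_add)
  have gen: "(of_real (d g) * fourier_coeff (heat_op \<sigma> d t x) g) *\<^sub>C Lam \<sigma> g
      = (d g * exp (- (t - s) * d g)) *\<^sub>R f g" for g
  proof -
    have "of_real (d g) * fourier_coeff (heat_op \<sigma> d t x) g
      = of_real (d g * exp (- t * d g)) * fourier_coeff x g"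
      by (simp add: fourier_coeff_heat_op[OF \<sigma> d less_imp_le[OF t] x])
    moreover have "d g * exp (- t * d g) = d g * exp (- (t - s) * d g) * exp (- s * d g)"
      by (simp add: algebra_simps flip: exp_add)
    ultimately show ?thesis by (simp only: scaleC_op_of_real_mult f_def y_def scaleR_scaleR)
  qed
  have ts: "t - s > 0" using t by (simp add: s_def)
  have "(\<lambda>g. (d g * exp (- (t - s) * d g)) *\<^sub>R f g) summable_on UNIV"
    by (rule summable_on_bounded_multiplier[OF f, of _ "1 / (t - s)"])
      (use mult_exp_le[OF ts d0] d0 in \<open>simp add: abs_mult\<close>)
  then show "heat_op \<sigma> d t x \<in> heat_dom \<sigma> d"
    unfolding heat_dom_def by (simp add: gen heat_op_Cr[OF \<sigma> d less_imp_le[OF t] x])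
  have "((\<lambda>r. \<Sum>\<^sub>\<infinity>g. exp (- r * d g) *\<^sub>R f g) has_vector_derivative heat_gen \<sigma> d (heat_op \<sigma> d t x))
      (at (t - s))"
    unfolding heat_gen_def gen by (rule has_vector_derivative_infsum_exp[OF f d0 ts])
  moreover have shift: "((\<lambda>r. r - s) has_vector_derivative 1) (at t)"
    by (auto intro!: derivative_eq_intros)
  ultimately have "((\<lambda>r. \<Sum>\<^sub>\<infinity>g. exp (- (r - s) * d g) *\<^sub>R f g) has_vector_derivative heat_gen \<sigma> d
      (heat_op \<sigma> d t x)) (at t)"
    using vector_diff_chain_at[OF shift, of "\<lambda>r. \<Sum>\<^sub>\<infinity>g. exp (- r * d g) *\<^sub>R f g"]
    by (simp only: o_def scaleR_one)
  then show "((\<lambda>t. heat_op \<sigma> d t x) has_vector_derivative heat_gen \<sigma> d (heat_op \<sigma> d t x)) (at t)"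
    by (rule has_vector_derivative_transform_within_open[of _ _ _ "{0<..}"]) (use t U in auto)
qed

text \<open>Each coefficient solves f' = - d(g) f on the open half-line only, so the initial value
  enters through the limit at 0 from the right.\<close>

lemma heat_solution_unique:
  assumes \<sigma>: "\<sigma> \<in> Z2" and d: "d \<in> ND0" and x: "x0 \<in> Cr \<sigma>"
    and v: "heat_solution \<sigma> d x0 v" and t: "t \<ge> 0"
  shows "v t = heat_op \<sigma> d t x0"
proof (cases "t = 0")
  case True
  then show ?thesis using v heat_op_0[OF \<sigma> d x] by (simp add: heat_solution_def)
next
  case False
  show ?thesis
  proof (rule Cr_eqI[OF \<sigma> _ heat_op_Cr[OF \<sigma> d t x]])
    show "v t \<in> Cr \<sigma>" using v t by (simp add: heat_solution_def)
    fix g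
    \<comment> \<open>The integrating factor makes the derivative of w vanish.\<close>
    define w where "w r = exp (r * d g) *\<^sub>R fourier_coeff (v r) g" for r
    have "(w has_vector_derivative 0) (at r within {0<..})" if "r > 0" for r
    proof -
      have "v r \<in> heat_dom \<sigma> d" "(v has_vector_derivative heat_gen \<sigma> d (v r)) (at r)"
        using v that by (auto simp: heat_solution_def)
      then have "((\<lambda>r. fourier_coeff (v r) g) has_vector_derivative - (d g *\<^sub>R fourier_coeff (v r)
          g)) (at r)"
        using bounded_linear.has_vector_derivative[OF bounded_linear_fourier_coeff, of v "heat_gen
            \<sigma> d (v r)" "at r" g]
        by (simp add: fourier_coeff_heat_gen[OF \<sigma>])
      moreover have "((\<lambda>r. exp (r * d g)) has_real_derivative d g * exp (r * d g)) (at r)"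
        by (auto intro!: derivative_eq_intros)
      ultimately have "(w has_vector_derivative exp (r * d g) *\<^sub>R - (d g *\<^sub>R fourier_coeff (v r) g)
          + (d g * exp (r * d g)) *\<^sub>R fourier_coeff (v r) g) (at r)"
        unfolding w_def by (intro has_vector_derivative_scaleR)
      then show ?thesis by (simp add: mult.commute has_vector_derivative_at_within)
    qed
    then obtain c where c: "\<And>r. r > 0 \<Longrightarrow> w r = c"
      using has_vector_derivative_zero_constant[of "{0<..}" w] by (auto simp: convex_real_interval)
    have "((\<lambda>r. v r) \<longlongrightarrow> x0) (at_right 0)"
      using v by (simp add: heat_solution_def tendsto_norm_zero_iff LIM_zero_iff)
    then have "((\<lambda>r. fourier_coeff (v r) g) \<longlongrightarrow> fourier_coeff x0 g) (at_right 0)"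
      by (rule bounded_linear.tendsto[OF bounded_linear_fourier_coeff])
    moreover have "((\<lambda>r. exp (r * d g)) \<longlongrightarrow> exp (0 * d g)) (at_right 0)"
      by (intro tendsto_intros)
    ultimately have "(w \<longlongrightarrow> exp (0 * d g) *\<^sub>R fourier_coeff x0 g) (at_right 0)"
      unfolding w_def by (intro tendsto_scaleR)
    moreover have "(w \<longlongrightarrow> c) (at_right 0)"
      by (rule tendsto_eventually) (use c eventually_at_right_less[of "0 :: real"] in \<open>auto elim:
          eventually_mono\<close>)
    ultimately have "c = fourier_coeff x0 g"
      using tendsto_unique[OF trivial_limit_at_right_real] by fastforce
    then have "exp (t * d g) *\<^sub>R fourier_coeff (v t) g = fourier_coeff x0 g"
      using c[of t] t False by (simp add: w_def)
    then have "exp (- t * d g) *\<^sub>R exp (t * d g) *\<^sub>R fourier_coeff (v t) g = exp (- t * d g) *\<^sub>R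
        fourier_coeff x0 g"
      by simp
    then show "fourier_coeff (v t) g = fourier_coeff (heat_op \<sigma> d t x0) g"
      unfolding fourier_coeff_heat_op[OF \<sigma> d t x]
      by (simp add: scaleR_conv_of_real flip: exp_add of_real_mult mult.assoc)
  qed
qed

theorem theorem4p7:
  fixes \<sigma> :: "'g::group_add \<Rightarrow> 'g \<Rightarrow> complex"
    and d :: "'g \<Rightarrow> real"
    and x0 :: "'g op"
    and u :: "real \<Rightarrow> 'g op"
  assumes "infinite (UNIV :: 'g set)" and "countable (UNIV :: 'g set)"
    and "\<sigma> \<in> Z2"
    and "d \<in> ND0"
    and "heat_property \<sigma> d"
    and "x0 \<in> Cr \<sigma>"
    and "\<And>t. t \<ge> 0 \<Longrightarrow> u t = heat_op \<sigma> d t x0"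
  shows "(\<forall>t>0. (\<lambda>g. fourier_coeff (u t) g *\<^sub>C Lam \<sigma> g) summable_on UNIV)
    \<and> heat_solution \<sigma> d x0 u
    \<and> (\<forall>v. heat_solution \<sigma> d x0 v \<longrightarrow> (\<forall>t\<ge>0. v t = u t))"
proof (intro conjI)
  note \<sigma> = assms(3) and d = assms(4) and hp = assms(5) and x = assms(6) and u = assms(7)
  show "\<forall>t>0. (\<lambda>g. fourier_coeff (u t) g *\<^sub>C Lam \<sigma> g) summable_on UNIV"
    using hp x u by (auto simp: heat_property_def CF_def)
  show "\<forall>v. heat_solution \<sigma> d x0 v \<longrightarrow> (\<forall>t\<ge>0. v t = u t)"
    using heat_solution_unique[OF \<sigma> d x] u by simp
  \<comment> \<open>Since u is prescribed on nonnegative times only, the derivative is transferred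
    within the open half-line.\<close>
  have "(u has_vector_derivative heat_gen \<sigma> d (u t)) (at t)" if "t > 0" for t
    using has_vector_derivative_transform_within_open[OF has_vector_derivative_heat_op[OF \<sigma> d hp x that], of "{0<..}" u]
      u that by simp
  moreover have "((\<lambda>t. norm (u t - x0)) \<longlongrightarrow> 0) (at_right 0)"
  proof -
    have "\<forall>\<^sub>F t in at_right 0. heat_op \<sigma> d t x0 = u t"
      using eventually_at_right_less[of "0 :: real"] by eventually_elim (simp add: u)
    then have "(u \<longlongrightarrow> x0) (at_right 0)"
      by (rule Lim_transform_eventually[OF heat_op_tendsto_at_right_0[OF \<sigma> d x]])
    then show ?thesis by (simp add: tendsto_norm_zero_iff LIM_zero_iff)
  qed
  ultimately show "heat_solution \<sigma> d x0 u"
    unfolding heat_solution_def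
    using heat_op_0[OF \<sigma> d x] heat_op_Cr[OF \<sigma> d _ x] heat_op_heat_dom[OF \<sigma> d hp x] by (simp add: u)
qed

end
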